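(* Let $F$ be an algebraically closed field of characteristic zero, $G$ a finite abelian group, and $A$ a finite dimensional $G$-simple $F$-algebra with presentation $P_A=(H,\alpha,\mathfrak g)$ and with connected grading. Then $A$ is $G$-graded strongly verbally prime if and only if the cosets of $H$ in $G$ are equally represented in $\mathfrak g$.
   Context: $F\langle X_G\rangle$ is the free associative algebra on $X_G=\{x_{i,g}: i\in\mathbb N, g\in G\}$, $G$-graded by letting $x_{i_1,g_1}\cdots x_{i_n,g_n}$ have degree $g_1\cdots g_n$; a polynomial is $G$-homogeneous if it lies in one homogeneous component. For a $G$-graded algebra $A=\oplus_{g\in G}A_g$, $Id_G(A)$ is the set of polynomials vanishing under all substitutions of the variables $x_{i,g}$ by elements of $A_g$. $A$ (PI as an ungraded algebra) is $G$-graded strongly verbally prime if for any $G$-homogeneous $f,g$ defined on disjoint sets of variables with $fg\in Id_G(A)$, either $f\in Id_G(A)$ or $g\in Id_G(A)$. The grading is connected if $\{g\in G: A_g\neq0\}$ generates $G$. A $G$-graded algebra is $G$-simple if its multiplication is nonzero and it has no nontrivial $G$-graded two-sided ideals. For a subgroup $H\le G$, a 2-cocycle $c\in Z^2(H,F^* )$ (trivial action) and $\mathfrak g=(g_1,\ldots,g_m)\in G^m$, let $F^cH$ be the twisted group algebra with basis $\{u_h\}_{h\in H}$, $u_hu_{h'}=c(h,h')u_{hh'}$, and grade $F^cH\otimes M_m(F)$ by $A_g=\mathrm{span}_F\{u_h\otimes e_{i,j}: g=g_i^{-1}hg_j\}$. Every finite dimensional $G$-simple $F$-algebra is $G$-graded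 isomorphic to such an algebra (Bahturin–Sehgal–Zaicev), and one says that $P_A=(H,[c],\mathfrak g)$ is a presentation of $A$. The cosets of $H$ are equally represented in $\mathfrak g$ if the number of indices $i$ with $g_i\in Hg$ is the same for every coset $Hg$. *)

theory Defs
  imports
    "HOL-Algebra.Coset"
    "HOL-Algebra.Generated_Groups"
    "HOL-Computational_Algebra.Polynomial"
    "HOL-Library.Poly_Mapping"
begin

section \<open>Free associative algebras\<close>

text \<open>
  The free monoid is wrapped in a type of its own, written additively, because then
  \<open>'v fmon \<Rightarrow>\<^sub>0 'f\<close> (its monoid algebra over \<open>'f\<close>, with the ring structure of
  \<^theory>\<open>HOL-Library.Poly_Mapping\<close>) is the free associative algebra, with \<open>1\<close>, on the
  variables \<open>'v\<close>.
\<close>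

datatype 'v fmon = Word (letters: "'v list")

instantiation fmon :: (type) monoid_add
begin

definition zero_fmon :: "'v fmon" where
  "zero_fmon = Word []"

definition plus_fmon :: "'v fmon \<Rightarrow> 'v fmon \<Rightarrow> 'v fmon" where
  "plus_fmon v w = Word (letters v @ letters w)"

instance
  by standard (simp_all add: zero_fmon_def plus_fmon_def)

end

type_synonym ('v, 'f) free_alg = "'v fmon \<Rightarrow>\<^sub>0 'f"

definition poly_vars :: "('v, 'f::zero) free_alg \<Rightarrow> 'v set" where
  "poly_vars f = (\<Union>w\<in>Poly_Mapping.keys f. set (letters w))"

text \<open>
  Algebras are not assumed to be unital, so only nonempty words have a value.
  The value of \<open>word_val\<close> on the empty word is never relevant.
\<close>

fun word_val :: "('v \<Rightarrow> 'a::ring) \<Rightarrow> 'v list \<Rightarrow> 'a" where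
  "word_val s [] = 0"
| "word_val s [x] = s x"
| "word_val s (x # y # xs) = s x * word_val s (y # xs)"

text \<open>
  A polynomial is evaluated in the unitization \<open>F \<oplus> A\<close>, where the \<open>F\<close>-component of its
  value is its constant term; this is why the constant term has to vanish. If \<open>A\<close> is unital
  and nonzero, this agrees with evaluation in \<open>A\<close> itself as far as identities are concerned:
  substituting zero for every variable shows that an identity has constant term zero.
\<close>

definition vanishes_at ::
    "('f::field \<Rightarrow> 'a::ring \<Rightarrow> 'a) \<Rightarrow> ('v \<Rightarrow> 'a) \<Rightarrow> ('v, 'f) free_alg \<Rightarrow> bool" where
  "vanishes_at scale s f \<longleftrightarrow>
     Poly_Mapping.lookup f 0 = 0 \<and>
     (\<Sum>w\<in>Poly_Mapping.keys f.
        scale (Poly_Mapping.lookup f w) (word_val s (letters w))) = 0"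

definition PI_algebra :: "('f::field \<Rightarrow> 'a::ring \<Rightarrow> 'a) \<Rightarrow> bool" where
  "PI_algebra scale \<longleftrightarrow>
     (\<exists>f :: (nat, 'f) free_alg. f \<noteq> 0 \<and> (\<forall>s. vanishes_at scale s f))"


section \<open>Graded algebras\<close>

text \<open>
  The algebra is a type \<open>'a\<close> with scalar multiplication \<open>scale\<close>, and \<open>A g\<close> is its
  homogeneous component of degree \<open>g\<close>; \<open>A\<close> is irrelevant outside the carrier of \<open>G\<close>.
\<close>

locale graded_algebra = group G + vector_space scale
  for G :: "('g, 'b) monoid_scheme" (structure)
    and scale :: "'f::field \<Rightarrow> 'a::ring \<Rightarrow> 'a"
    and A :: "'g \<Rightarrow> 'a set" +
  assumes scale_mult_left: "scale c x * y = scale c (x * y)"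
    and scale_mult_right: "x * scale c y = scale c (x * y)"
    and subspace_component: "g \<in> carrier G \<Longrightarrow> subspace (A g)"
    and components_span: "span (\<Union>g\<in>carrier G. A g) = UNIV"
    and components_direct:
      "\<lbrakk>finite S; S \<subseteq> carrier G; \<And>g. g \<in> S \<Longrightarrow> d g \<in> A g; (\<Sum>g\<in>S. d g) = 0; g \<in> S\<rbrakk>
        \<Longrightarrow> d g = 0"
    and components_mult:
      "\<lbrakk>g \<in> carrier G; h \<in> carrier G; a \<in> A g; b \<in> A h\<rbrakk> \<Longrightarrow> a * b \<in> A (g \<otimes> h)"

definition finite_dim_algebra :: "('f::field \<Rightarrow> 'a::ring \<Rightarrow> 'a) \<Rightarrow> bool" where
  "finite_dim_algebra scale \<longleftrightarrow> (\<exists>B. finite B \<and> module.span scale B = UNIV)"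

definition graded_ideal ::
    "('g, 'b) monoid_scheme \<Rightarrow> ('f::field \<Rightarrow> 'a::ring \<Rightarrow> 'a) \<Rightarrow> ('g \<Rightarrow> 'a set) \<Rightarrow> 'a set \<Rightarrow> bool"
  where
  "graded_ideal G scale A I \<longleftrightarrow>
     module.subspace scale I \<and>
     (\<forall>x\<in>I. \<forall>y. x * y \<in> I \<and> y * x \<in> I) \<and>
     I = module.span scale (\<Union>g\<in>carrier G. I \<inter> A g)"

definition graded_simple ::
    "('g, 'b) monoid_scheme \<Rightarrow> ('f::field \<Rightarrow> 'a::ring \<Rightarrow> 'a) \<Rightarrow> ('g \<Rightarrow> 'a set) \<Rightarrow> bool" where
  "graded_simple G scale A \<longleftrightarrow>
     (\<exists>x y :: 'a. x * y \<noteq> 0) \<and>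
     (\<forall>I. graded_ideal G scale A I \<longrightarrow> I = {0} \<or> I = UNIV)"

definition connected_grading ::
    "('g, 'b) monoid_scheme \<Rightarrow> ('g \<Rightarrow> 'a::zero set) \<Rightarrow> bool" where
  "connected_grading G A \<longleftrightarrow> generate G {g \<in> carrier G. A g \<noteq> {0}} = carrier G"


section \<open>Graded identities\<close>

text \<open>The variable \<open>(i, g)\<close> stands for $x_{i,g}$.\<close>

definition graded_polys ::
    "('g, 'b) monoid_scheme \<Rightarrow> (nat \<times> 'g, 'f::field) free_alg set" where
  "graded_polys G = {f. poly_vars f \<subseteq> UNIV \<times> carrier G}"

definition word_degree :: "('g, 'b) monoid_scheme \<Rightarrow> (nat \<times> 'g) list \<Rightarrow> 'g" where
  "word_degree G xs = foldr (\<lambda>x d. snd x \<otimes>\<^bsub>G\<^esub> d) xs \<one>\<^bsub>G\<^esub>"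

definition homogeneous ::
    "('g, 'b) monoid_scheme \<Rightarrow> (nat \<times> 'g, 'f::field) free_alg \<Rightarrow> bool" where
  "homogeneous G f \<longleftrightarrow>
     (\<exists>g\<in>carrier G. \<forall>w\<in>Poly_Mapping.keys f. word_degree G (letters w) = g)"

definition graded_ids ::
    "('g, 'b) monoid_scheme \<Rightarrow> ('f::field \<Rightarrow> 'a::ring \<Rightarrow> 'a) \<Rightarrow> ('g \<Rightarrow> 'a set) \<Rightarrow>
      (nat \<times> 'g, 'f) free_alg set" where
  "graded_ids G scale A =
     {f \<in> graded_polys G.
        \<forall>s. (\<forall>i. \<forall>g\<in>carrier G. s (i, g) \<in> A g) \<longrightarrow> vanishes_at scale s f}"

definition strongly_verbally_prime ::
    "('g, 'b) monoid_scheme \<Rightarrow> ('f::field \<Rightarrow> 'a::ring \<Rightarrow> 'a) \<Rightarrow> ('g \<Rightarrow> 'a set) \<Rightarrow> bool" where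
  "strongly_verbally_prime G scale A \<longleftrightarrow>
     PI_algebra scale \<and>
     (\<forall>p\<in>graded_polys G. \<forall>q\<in>graded_polys G.
        homogeneous G p \<longrightarrow> homogeneous G q \<longrightarrow> poly_vars p \<inter> poly_vars q = {} \<longrightarrow>
        p * q \<in> graded_ids G scale A \<longrightarrow>
        p \<in> graded_ids G scale A \<or> q \<in> graded_ids G scale A)"


section \<open>Presentations\<close>

text \<open>
  Cocycles and cochains are total functions whose values outside of \<open>H\<close> are irrelevant.
  A cohomology class contains all variants of its elements outside of \<open>H\<close>.
\<close>

definition cocycles ::
    "('g, 'b) monoid_scheme \<Rightarrow> 'g set \<Rightarrow> ('g \<Rightarrow> 'g \<Rightarrow> 'f::field) set" where
  "cocycles G H =
     {c. (\<forall>x\<in>H. \<forall>y\<in>H. c x y \<noteq> 0) \<and>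
         (\<forall>x\<in>H. \<forall>y\<in>H. \<forall>z\<in>H. c x y * c (x \<otimes>\<^bsub>G\<^esub> y) z = c y z * c x (y \<otimes>\<^bsub>G\<^esub> z))}"

definition cohomology_class ::
    "('g, 'b) monoid_scheme \<Rightarrow> 'g set \<Rightarrow> ('g \<Rightarrow> 'g \<Rightarrow> 'f::field) \<Rightarrow> ('g \<Rightarrow> 'g \<Rightarrow> 'f) set" where
  "cohomology_class G H c =
     {d \<in> cocycles G H. \<exists>l. (\<forall>x\<in>H. l x \<noteq> 0) \<and>
        (\<forall>x\<in>H. \<forall>y\<in>H. d x y = l x * l y / l (x \<otimes>\<^bsub>G\<^esub> y) * c x y)}"

text \<open>
  $F^cH \otimes M_m(F)$ is realised inside the finitely supported functions
  \<open>'g \<times> nat \<times> nat \<Rightarrow>\<^sub>0 'f\<close>, with \<open>Poly_Mapping.single (h, i, j) 1\<close> in the role of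
  $u_h \otimes e_{i,j}$ and matrix indices starting from \<open>0\<close>. The multiplication is the
  bilinear extension of $(u_h \otimes e_{i,j}) (u_{h'} \otimes e_{k,l}) =
  c(h,h') u_{hh'} \otimes e_{i,j} e_{k,l}$.
\<close>

type_synonym ('g, 'f) tw_mat = "'g \<times> nat \<times> nat \<Rightarrow>\<^sub>0 'f"

definition tw_scale :: "'f::field \<Rightarrow> ('g, 'f) tw_mat \<Rightarrow> ('g, 'f) tw_mat" where
  "tw_scale a x = Poly_Mapping.map ((*) a) x"

definition tw_mult ::
    "('g, 'b) monoid_scheme \<Rightarrow> ('g \<Rightarrow> 'g \<Rightarrow> 'f::field) \<Rightarrow>
      ('g, 'f) tw_mat \<Rightarrow> ('g, 'f) tw_mat \<Rightarrow> ('g, 'f) tw_mat" where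
  "tw_mult G c x y =
     (\<Sum>(h, i, j)\<in>Poly_Mapping.keys x. \<Sum>(h', k, l)\<in>Poly_Mapping.keys y.
        if j = k
        then Poly_Mapping.single (h \<otimes>\<^bsub>G\<^esub> h', i, l)
               (Poly_Mapping.lookup x (h, i, j) * Poly_Mapping.lookup y (h', k, l) * c h h')
        else 0)"

definition tw_carrier :: "'g set \<Rightarrow> nat \<Rightarrow> ('g, 'f::field) tw_mat set" where
  "tw_carrier H m =
     module.span tw_scale {Poly_Mapping.single (h, i, j) 1 | h i j. h \<in> H \<and> i < m \<and> j < m}"

definition tw_component ::
    "('g, 'b) monoid_scheme \<Rightarrow> 'g set \<Rightarrow> 'g list \<Rightarrow> 'g \<Rightarrow> ('g, 'f::field) tw_mat set" where
  "tw_component G H gs g =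
     module.span tw_scale
       {Poly_Mapping.single (h, i, j) 1 | h i j.
          h \<in> H \<and> i < length gs \<and> j < length gs \<and>
          g = inv\<^bsub>G\<^esub> (gs ! i) \<otimes>\<^bsub>G\<^esub> h \<otimes>\<^bsub>G\<^esub> (gs ! j)}"

definition graded_iso_tw ::
    "('g, 'b) monoid_scheme \<Rightarrow> ('f::field \<Rightarrow> 'a::ring \<Rightarrow> 'a) \<Rightarrow> ('g \<Rightarrow> 'a set) \<Rightarrow>
      'g set \<Rightarrow> ('g \<Rightarrow> 'g \<Rightarrow> 'f) \<Rightarrow> 'g list \<Rightarrow> (('g, 'f) tw_mat \<Rightarrow> 'a) \<Rightarrow> bool" where
  "graded_iso_tw G scale A H c gs \<phi> \<longleftrightarrow>
     bij_betw \<phi> (tw_carrier H (length gs)) UNIV \<and>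
     (\<forall>x\<in>tw_carrier H (length gs). \<forall>y\<in>tw_carrier H (length gs).
        \<phi> (x + y) = \<phi> x + \<phi> y \<and> \<phi> (tw_mult G c x y) = \<phi> x * \<phi> y) \<and>
     (\<forall>a. \<forall>x\<in>tw_carrier H (length gs). \<phi> (tw_scale a x) = scale a (\<phi> x)) \<and>
     (\<forall>g\<in>carrier G. \<phi> ` tw_component G H gs g = A g)"

definition is_presentation ::
    "('g, 'b) monoid_scheme \<Rightarrow> ('f::field \<Rightarrow> 'a::ring \<Rightarrow> 'a) \<Rightarrow> ('g \<Rightarrow> 'a set) \<Rightarrow>
      'g set \<times> ('g \<Rightarrow> 'g \<Rightarrow> 'f) set \<times> 'g list \<Rightarrow> bool" where
  "is_presentation G scale A = (\<lambda>(H, \<alpha>, gs).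
     subgroup H G \<and> set gs \<subseteq> carrier G \<and>
     (\<exists>c\<in>cocycles G H. \<alpha> = cohomology_class G H c \<and>
        (\<exists>\<phi>. graded_iso_tw G scale A H c gs \<phi>)))"

definition equally_represented ::
    "('g, 'b) monoid_scheme \<Rightarrow> 'g set \<Rightarrow> 'g list \<Rightarrow> bool" where
  "equally_represented G H gs \<longleftrightarrow>
     (\<forall>C\<in>rcosets\<^bsub>G\<^esub> H. \<forall>D\<in>rcosets\<^bsub>G\<^esub> H.
        card {i. i < length gs \<and> gs ! i \<in> C} = card {i. i < length gs \<and> gs ! i \<in> D})"

end

theory Submission
  imports Defs "HOL-Combinatorics.Permutations" "HOL-Library.Nat_Bijection"
begin

text \<open>
  Through a presentation, \<open>A\<close> becomes the algebra with basis \<open>E (h, i, j)\<close>, where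
  \<open>h \<in> H\<close> and \<open>i, j < m\<close>, with the twisted matrix unit multiplication. Row \<open>i\<close> is labelled by the coset
  \<open>H g\<^sub>i\<close>, and an element of degree \<open>g\<close> only has coordinates in positions \<open>(i, j)\<close> with
  \<open>H g\<^sub>i g = H g\<^sub>j\<close>: homogeneous elements move rows according to the translation action of
  \<open>G\<close> on \<open>G/H\<close>. Let \<open>d(x)\<close> be the number of rows labelled by \<open>H x\<close>; the claim is that \<open>A\<close> is
  strongly verbally prime if and only if \<open>d\<close> is constant.

  Let \<open>d\<close> be constant. Translation by any \<open>g\<close> is then induced by a permutation of the rows, and the
  corresponding monomial matrices are invertible and homogeneous of degree \<open>g\<close>
  (\<open>coset_shift_permutation\<close>, \<open>monomial_invertible\<close>). Because \<open>G\<close> is abelian, conjugation by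
  them preserves degrees, so the values of a polynomial may be conjugated by them. If \<open>p\<close> and \<open>q\<close> in
  disjoint variables have nonzero values \<open>a\<close> and \<open>b\<close> while \<open>p q\<close> is an identity, then
  \<open>a X b = 0\<close> for all these invertible \<open>X\<close>. Every basis element is a difference of two of them,
  hence \<open>a E (h, j, k) b = 0\<close> for all \<open>h, j, k\<close>. This is impossible: in a fixed position a
  homogeneous element has at most one coordinate, so that multiplying \<open>a\<close> and \<open>b\<close> from both sides by suitable
  basis elements isolates nonzero multiples of basis elements which can then be linked.
  That \<open>A\<close> satisfies a polynomial identity at all is a consequence of its finite dimension, by
  way of a Capelli polynomial.

  Conversely, let \<open>A\<close> be strongly verbally prime. The degrees \<open>g\<close> with \<open>A g \<noteq> {0}\<close>
  are closed under multiplication, hence are all of \<open>G\<close> by connectedness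
  (\<open>all_components_nonzero\<close>). Let \<open>d\<^sub>0\<close> be the largest value of \<open>d\<close>. The component of degree
  \<open>\<one>\<close> is the product of full matrix algebras of sizes \<open>d(x)\<close>, one for each coset \<open>H x\<close>, and the
  Capelli polynomial \<open>f\<close> with \<open>d\<^sub>0\<^sup>2\<close> alternating variables of degree \<open>\<one>\<close> vanishes exactly on the
  factors of smaller size (\<open>capelli_block_support\<close>, \<open>capelli_block_not_identity\<close>). Strong verbal
  primeness makes every product \<open>z f z' f' z'' f'' \<dots>\<close> of single variables and renamed copies of
  \<open>f\<close> a nonidentity, whatever the degrees of the variables. A row in which such a product has a
  nonzero coordinate stays within cosets with \<open>d = d\<^sub>0\<close> under all translations by the partial
  products of the degrees. Letting these run through \<open>G\<close>
  (\<open>polynomial_with_full_support\<close>) shows that \<open>d\<close> is \<open>d\<^sub>0\<close> everywhere.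
\<close>

section \<open>Homogeneous linear systems\<close>

lemma linear_system_nontrivial_solution:
  fixes v :: "'j \<Rightarrow> 'p \<Rightarrow> 'f::field"
  assumes "finite P" "finite J" "card P < card J"
  shows "\<exists>\<beta>. (\<exists>j\<in>J. \<beta> j \<noteq> 0) \<and> (\<forall>p\<in>P. (\<Sum>j\<in>J. \<beta> j * v j p) = 0)"
  using assms
proof (induction P arbitrary: J v rule: finite_induct)
  case empty
  then have "J \<noteq> {}" by auto
  then show ?case by (intro exI[of _ "\<lambda>_. 1"]) auto
next
  case (insert p P)
  show ?case
  proof (cases "\<forall>j\<in>J. v j p = 0")
    case True
    have "card P < card J" using insert by simp
    from insert.IH[OF insert.prems(1) this, of v] obtain \<beta> where
      "\<exists>j\<in>J. \<beta> j \<noteq> 0" "\<forall>q\<in>P. (\<Sum>j\<in>J. \<beta> j * v j q) = 0" by blast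
    with True show ?thesis by (intro exI[of _ \<beta>]) simp
  next
    case False
    then obtain j1 where j1: "j1 \<in> J" "v j1 p \<noteq> 0" by blast
    \<comment> \<open>Gaussian elimination: equation \<open>p\<close> is solved for the unknown \<open>j1\<close>.\<close>
    define J' where "J' = J - {j1}"
    have J': "finite J'" "card P < card J'" "j1 \<notin> J'" "J = insert j1 J'"
      using insert j1 by (auto simp: J'_def)
    define w where "w j q = v j q - v j p / v j1 p * v j1 q" for j q
    from insert.IH[OF J'(1,2), of w] obtain \<beta> where
      b: "\<exists>j\<in>J'. \<beta> j \<noteq> 0" "\<And>q. q \<in> P \<Longrightarrow> (\<Sum>j\<in>J'. \<beta> j * w j q) = 0" by blast
    define b1 where "b1 = - (\<Sum>j\<in>J'. \<beta> j * v j p) / v j1 p"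
    define \<gamma> where "\<gamma> = \<beta>(j1 := b1)"
    have split: "(\<Sum>j\<in>J. \<gamma> j * v j q) = b1 * v j1 q + (\<Sum>j\<in>J'. \<beta> j * v j q)" for q
    proof -
      have "(\<Sum>j\<in>J'. \<gamma> j * v j q) = (\<Sum>j\<in>J'. \<beta> j * v j q)"
        using J'(3) by (intro sum.cong) (auto simp: \<gamma>_def)
      then show ?thesis using J' by (simp add: \<gamma>_def)
    qed
    have "(\<Sum>j\<in>J. \<gamma> j * v j p) = 0"
      using j1(2) by (simp add: split b1_def)
    moreover have "(\<Sum>j\<in>J. \<gamma> j * v j q) = 0" if "q \<in> P" for q
    proof -
      have "(\<Sum>j\<in>J'. \<beta> j * w j q)
          = (\<Sum>j\<in>J'. \<beta> j * v j q) - (\<Sum>j\<in>J'. \<beta> j * v j p) / v j1 p * v j1 q"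
        by (simp add: w_def sum_subtractf right_diff_distrib sum_divide_distrib sum_distrib_right
            mult.assoc)
      with b(2)[OF that] show ?thesis by (simp add: split b1_def)
    qed
    moreover have "\<exists>j\<in>J. \<gamma> j \<noteq> 0"
      using b(1) J'(3,4) by (auto simp: \<gamma>_def)
    ultimately show ?thesis by blast
  qed
qed

section \<open>Evaluation of polynomials in a unital algebra\<close>

text \<open>
  Polynomials with a constant term can be evaluated in \<open>A\<close> itself once the empty word gets the unit
  as its value. Evaluation is then a homomorphism of algebras, which \<^const>\<open>word_val\<close> cannot offer.
  The unit is a parameter: in the application it is a combination of diagonal basis elements that
  is known only after a choice of coordinates.
\<close>

locale unital_algebra = vector_space scale
  for scale :: "'f::field \<Rightarrow> 'a::ring \<Rightarrow> 'a" +
  fixes u :: 'a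
  assumes mult_scale_left: "scale c x * y = scale c (x * y)"
    and mult_scale_right: "x * scale c y = scale c (x * y)"
    and unit_left [simp]: "u * x = x"
    and unit_right [simp]: "x * u = x"
    and unit_nonzero: "u \<noteq> 0"
begin

definition wv :: "('v \<Rightarrow> 'a) \<Rightarrow> 'v list \<Rightarrow> 'a" where
  "wv s w = foldr (\<lambda>x a. s x * a) w u"

definition ev :: "('v \<Rightarrow> 'a) \<Rightarrow> ('v, 'f) free_alg \<Rightarrow> 'a" where
  "ev s p = (\<Sum>w\<in>Poly_Mapping.keys p. scale (Poly_Mapping.lookup p w) (wv s (letters w)))"

lemma wv_simps [simp]: "wv s [] = u" "wv s (x # w) = s x * wv s w"
  by (simp_all add: wv_def)

lemma wv_append: "wv s (v @ w) = wv s v * wv s w"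
  by (induction v) (simp_all add: mult.assoc)

lemma word_val_eq_wv: "w \<noteq> [] \<Longrightarrow> word_val s w = wv s w"
  by (induction s w rule: word_val.induct) simp_all

lemma ev_superset:
  assumes "finite W" "Poly_Mapping.keys p \<subseteq> W"
  shows "ev s p = (\<Sum>w\<in>W. scale (Poly_Mapping.lookup p w) (wv s (letters w)))"
  unfolding ev_def using assms
  by (intro sum.mono_neutral_left) (auto simp: in_keys_iff)

lemma ev_zero [simp]: "ev s 0 = 0"
  by (simp add: ev_def)

lemma ev_add: "ev s (p + q) = ev s p + ev s q"
proof -
  let ?W = "Poly_Mapping.keys p \<union> Poly_Mapping.keys q"
  have "Poly_Mapping.keys (p + q) \<subseteq> ?W" by (rule Poly_Mapping.keys_add)
  then show ?thesis
    by (simp add: ev_superset[of ?W] lookup_add scale_left_distrib sum.distrib)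
qed

lemma ev_sum: "ev s (\<Sum>i\<in>I. f i) = (\<Sum>i\<in>I. ev s (f i))"
  by (induction I rule: infinite_finite_induct) (simp_all add: ev_add)

lemma ev_single [simp]: "ev s (Poly_Mapping.single w c) = scale c (wv s (letters w))"
  by (cases "c = 0") (simp_all add: ev_def)

lemma poly_sum_singles:
  "p = (\<Sum>w\<in>Poly_Mapping.keys p. Poly_Mapping.single w (Poly_Mapping.lookup p w))"
  by (rule poly_mapping_eqI)
    (auto simp: lookup_sum lookup_single when_def in_keys_iff)

lemma ev_mult: "ev s (p * q) = ev s p * ev s q"
proof -
  have "ev s (p * q) = ev s ((\<Sum>v\<in>Poly_Mapping.keys p. Poly_Mapping.single v (Poly_Mapping.lookup p v))
      * (\<Sum>w\<in>Poly_Mapping.keys q. Poly_Mapping.single w (Poly_Mapping.lookup q w)))"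
    by (simp flip: poly_sum_singles)
  also have "\<dots> = (\<Sum>v\<in>Poly_Mapping.keys p. \<Sum>w\<in>Poly_Mapping.keys q.
      scale (Poly_Mapping.lookup p v) (wv s (letters v)) * scale (Poly_Mapping.lookup q w) (wv s (letters w)))"
    by (simp add: sum_product mult_single ev_sum plus_fmon_def
        wv_append mult_scale_left mult_scale_right mult.commute)
  also have "\<dots> = ev s p * ev s q"
    by (simp add: ev_def sum_product)
  finally show ?thesis .
qed

lemma ev_cong:
  assumes "\<And>x. x \<in> poly_vars p \<Longrightarrow> s x = t x"
  shows "ev s p = ev t p"
proof -
  have "wv s w = wv t w" if "set w \<subseteq> poly_vars p" for w
    using that by (induction w) (simp_all add: assms)
  then show ?thesis
    unfolding ev_def by (intro sum.cong) (auto simp: poly_vars_def)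
qed


lemma ev_split_constant:
  "ev s p = scale (Poly_Mapping.lookup p 0) u
     + (\<Sum>w\<in>Poly_Mapping.keys p - {0}. scale (Poly_Mapping.lookup p w) (word_val s (letters w)))"
proof -
  have "ev s p = (\<Sum>w\<in>insert 0 (Poly_Mapping.keys p - {0}).
      scale (Poly_Mapping.lookup p w) (wv s (letters w)))"
    by (intro ev_superset) auto
  also have "\<dots> = scale (Poly_Mapping.lookup p 0) u
     + (\<Sum>w\<in>Poly_Mapping.keys p - {0}. scale (Poly_Mapping.lookup p w) (wv s (letters w)))"
    by (subst sum.insert) (simp_all add: zero_fmon_def)
  also have "(\<Sum>w\<in>Poly_Mapping.keys p - {0}. scale (Poly_Mapping.lookup p w) (wv s (letters w)))
     = (\<Sum>w\<in>Poly_Mapping.keys p - {0}. scale (Poly_Mapping.lookup p w) (word_val s (letters w)))"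
  proof (intro sum.cong refl)
    fix w assume "w \<in> Poly_Mapping.keys p - {0}"
    then have "letters w \<noteq> []" by (cases w) (auto simp: zero_fmon_def)
    then show "scale (Poly_Mapping.lookup p w) (wv s (letters w))
        = scale (Poly_Mapping.lookup p w) (word_val s (letters w))"
      by (simp add: word_val_eq_wv)
  qed
  finally show ?thesis .
qed

text \<open>
  The evaluation in the unitization and the one in \<open>A\<close> differ only in where the constant term is
  stored.
\<close>

lemma vanishes_at_iff:
  "vanishes_at scale s p \<longleftrightarrow> Poly_Mapping.lookup p 0 = 0 \<and> ev s p = 0"
proof (cases "Poly_Mapping.lookup p 0 = 0")
  case True
  then have "Poly_Mapping.keys p - {0} = Poly_Mapping.keys p" by (auto simp: in_keys_iff)
  with True show ?thesis by (simp add: vanishes_at_def ev_split_constant)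
qed (simp add: vanishes_at_def)

lemma ev_at_zero:
  fixes p :: "('v, 'f) free_alg"
  shows "ev (\<lambda>_. 0) p = scale (Poly_Mapping.lookup p 0) u"
proof -
  have "word_val (\<lambda>_. 0) w = (0::'a)" for w :: "'v list"
    by (induction "\<lambda>_::'v. 0::'a" w rule: word_val.induct) simp_all
  then show ?thesis by (simp add: ev_split_constant)
qed

text \<open>
  Hence the constant term of an identity of the unital algebra is zero, and the separate condition on
  it in \<^const>\<open>vanishes_at\<close> follows as soon as zero is an admissible substitution.
\<close>

lemma lookup_zero_if_ev_at_zero:
  "ev (\<lambda>_. 0) p = 0 \<Longrightarrow> Poly_Mapping.lookup p 0 = 0"
  using unit_nonzero by (simp add: ev_at_zero)

end

section \<open>Capelli polynomials\<close>

text \<open>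
  Each alternating variable sits between two variables \<open>y k\<close> and \<open>z k\<close> of its own, which fix the
  place \<open>k\<close>. With matrix units for values, the factor \<open>y k * x (\<sigma> k) * z k\<close> can be made a
  multiple of one fixed idempotent which is nonzero only for \<open>\<sigma> k = k\<close>.
\<close>

definition capelli_word :: "nat \<Rightarrow> (nat \<Rightarrow> 'v) \<Rightarrow> (nat \<Rightarrow> 'v) \<Rightarrow> (nat \<Rightarrow> 'v) \<Rightarrow> (nat \<Rightarrow> nat) \<Rightarrow> 'v list"
  where "capelli_word N x y z \<sigma> = concat (map (\<lambda>k. [y k, x (\<sigma> k), z k]) [0..<N])"

definition capelli ::
    "nat \<Rightarrow> (nat \<Rightarrow> 'v) \<Rightarrow> (nat \<Rightarrow> 'v) \<Rightarrow> (nat \<Rightarrow> 'v) \<Rightarrow> ('v, 'f::comm_ring_1) free_alg" where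
  "capelli N x y z =
     (\<Sum>\<sigma> | \<sigma> permutes {..<N}. Poly_Mapping.single (Word (capelli_word N x y z \<sigma>)) (of_int (sign \<sigma>)))"

lemma set_capelli_word:
  "\<sigma> permutes {..<N} \<Longrightarrow> set (capelli_word N x y z \<sigma>) \<subseteq> x ` {..<N} \<union> y ` {..<N} \<union> z ` {..<N}"
  using permutes_in_image[of \<sigma> "{..<N}"] by (fastforce simp: capelli_word_def)

lemma keys_capelli:
  "Poly_Mapping.keys (capelli N x y z) \<subseteq> (\<lambda>\<sigma>. Word (capelli_word N x y z \<sigma>)) ` {\<sigma>. \<sigma> permutes {..<N}}"
  unfolding capelli_def
  by (rule order.trans[OF keys_sum]) (auto split: if_splits)

lemma poly_vars_capelli:
  "poly_vars (capelli N x y z :: ('a, 'b::comm_ring_1) free_alg) \<subseteq> x ` {..<N} \<union> y ` {..<N} \<union> z ` {..<N}"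
proof
  fix v assume "v \<in> poly_vars (capelli N x y z :: ('a, 'b) free_alg)"
  then obtain w where w: "w \<in> Poly_Mapping.keys (capelli N x y z :: ('a, 'b) free_alg)"
    and v: "v \<in> set (letters w)" by (auto simp: poly_vars_def)
  from w keys_capelli obtain \<sigma> where "\<sigma> permutes {..<N}" "w = Word (capelli_word N x y z \<sigma>)"
    by blast
  with v show "v \<in> x ` {..<N} \<union> y ` {..<N} \<union> z ` {..<N}"
    using set_capelli_word[of \<sigma> N x y z] by auto
qed

text \<open>
  The alternating variables of a word, read from left to right, determine its permutation. Hence
  the word of the identity permutation has coefficient \<open>1\<close>.
\<close>

lemma capelli_nonzero:
  fixes x y z :: "nat \<Rightarrow> 'v"
  assumes "inj x"
  shows "capelli N x y z \<noteq> (0 :: ('v, 'f::comm_ring_1) free_alg)"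
proof -
  have eq: "\<sigma> = id" if s: "\<sigma> permutes {..<N}" and e: "capelli_word N x y z \<sigma> = capelli_word N x y z id" for \<sigma>
  proof
    fix k
    have "map (\<lambda>k. [y k, x (\<sigma> k), z k]) [0..<N] = map (\<lambda>k. [y k, x (id k), z k]) [0..<N]"
      using e unfolding capelli_word_def
      by (subst (asm) concat_eq_concat_iff) (auto simp: set_zip)
    then show "\<sigma> k = id k"
      using assms s by (cases "k < N") (auto simp: inj_eq permutes_def)
  qed
  have "Poly_Mapping.lookup (capelli N x y z) (Word (capelli_word N x y z id))
      = (\<Sum>\<sigma> | \<sigma> permutes {..<N}. if \<sigma> = id then 1 else (0::'f))"
    unfolding capelli_def lookup_sum lookup_single
    by (intro sum.cong) (auto simp: when_def dest: eq)
  also have "\<dots> = 1"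
    by (simp add: sum.delta finite_permutations permutes_id)
  finally show ?thesis by auto
qed

context unital_algebra
begin

lemma ev_capelli:
  "ev s (capelli N x y z) = (\<Sum>\<sigma> | \<sigma> permutes {..<N}. scale (of_int (sign \<sigma>))
     (foldr (\<lambda>k a. s (y k) * s (x (\<sigma> k)) * s (z k) * a) [0..<N] u))"
proof -
  have "wv s (concat (map (\<lambda>k. [y k, x (\<sigma> k), z k]) ks))
      = foldr (\<lambda>k a. s (y k) * s (x (\<sigma> k)) * s (z k) * a) ks u" for \<sigma> and ks :: "nat list"
    by (induction ks) (simp_all add: wv_append mult.assoc)
  then show ?thesis by (simp add: capelli_def ev_sum capelli_word_def)
qed

end

locale char_0_unital_algebra = unital_algebra scale u
  for scale :: "'f::field_char_0 \<Rightarrow> 'a::ring \<Rightarrow> 'a" and u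
begin

definition alternating_sum :: "nat \<Rightarrow> (nat \<Rightarrow> 'a) \<Rightarrow> (nat \<Rightarrow> 'a) \<Rightarrow> (nat \<Rightarrow> 'a) \<Rightarrow> 'a" where
  "alternating_sum N Y Z X = (\<Sum>\<sigma> | \<sigma> permutes {..<N}. scale (of_int (sign \<sigma>))
     (foldr (\<lambda>k a. Y k * X (\<sigma> k) * Z k * a) [0..<N] u))"

text \<open>
  Composing with the transposition of \<open>i\<close> and \<open>j\<close> changes the sign of each term but not its
  product, so the sum is its own negative.
\<close>

lemma alternating_sum_repeated:
  assumes ij: "i < N" "j < N" "i \<noteq> j" and eq: "X i = X j"
  shows "alternating_sum N Y Z X = 0"
proof -
  let ?t = "transpose i j"
  let ?P = "\<lambda>\<sigma>. foldr (\<lambda>k a. Y k * X (\<sigma> k) * Z k * a) [0..<N] u"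
  have t: "?t permutes {..<N}" using ij by (simp add: permutes_swap_id)
  have "X (?t k) = X k" for k using eq by (simp add: transpose_def)
  then have P: "?P (?t \<circ> \<sigma>) = ?P \<sigma>" for \<sigma> by simp
  have "alternating_sum N Y Z X = (\<Sum>\<sigma> | \<sigma> permutes {..<N}. scale (of_int (sign (?t \<circ> \<sigma>))) (?P (?t \<circ> \<sigma>)))"
    unfolding alternating_sum_def by (rule setum_permutations_compose_left[OF t])
  also have "\<dots> = (\<Sum>\<sigma> | \<sigma> permutes {..<N}. - scale (of_int (sign \<sigma>)) (?P \<sigma>))"
  proof (intro sum.cong refl)
    fix \<sigma> assume "\<sigma> \<in> {\<sigma>. \<sigma> permutes {..<N}}"
    then have "permutation \<sigma>" by (auto simp: permutation_permutes)
    then have "sign (?t \<circ> \<sigma>) = - sign \<sigma>"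
      using ij(3) by (simp add: sign_compose permutation_swap_id sign_swap_id)
    then show "scale (of_int (sign (?t \<circ> \<sigma>))) (?P (?t \<circ> \<sigma>)) = - scale (of_int (sign \<sigma>)) (?P \<sigma>)"
      unfolding P by (simp add: scale_minus_left)
  qed
  also have "\<dots> = - alternating_sum N Y Z X" by (simp add: alternating_sum_def sum_negf)
  finally have "scale 2 (alternating_sum N Y Z X) = 0"
    using scale_left_distrib[of 1 1] by (simp add: eq_neg_iff_add_eq_0)
  then show ?thesis by simp
qed

text \<open>
  Every term contains the argument with index \<open>j\<close> exactly once. The left factor \<open>L\<close> is a product of other
  arguments; that it lies in \<open>B\<close> matters where \<open>W\<close> below is a left ideal only with
  respect to \<open>B\<close>.
\<close>

lemma alternating_sum_slot:
  assumes \<sigma>: "\<sigma> permutes {..<N}" and j: "j < N"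
    and B: "u \<in> B" "\<And>a b. a \<in> B \<Longrightarrow> b \<in> B \<Longrightarrow> a * b \<in> B"
      "\<And>k. k < N \<Longrightarrow> Y k \<in> B" "\<And>k. k < N \<Longrightarrow> Z k \<in> B" "\<And>k. k < N \<Longrightarrow> X k \<in> B"
  shows "\<exists>L R. L \<in> B \<and> (\<forall>a. foldr (\<lambda>k a'. Y k * (X(j := a)) (\<sigma> k) * Z k * a') [0..<N] u = L * a * R)"
proof -
  from \<sigma> j obtain k0 where k0: "k0 < N" "\<sigma> k0 = j"
    by (metis lessThan_iff permutes_def permutes_in_image)
  have only: "\<sigma> k = j \<longleftrightarrow> k = k0" for k
    using permutes_inj[OF \<sigma>] k0(2) by (auto dest: injD)
  let ?m = "\<lambda>X k. Y k * X (\<sigma> k) * Z k"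
  have list: "[0..<N] = [0..<k0] @ k0 # [Suc k0..<N]"
    using k0(1) upt_add_eq_append[of 0 k0 "N - k0"] by (simp add: upt_conv_Cons)
  have fold_mult: "foldr (\<lambda>k. (*) (f k)) ks b = foldr (\<lambda>k. (*) (f k)) ks u * b"
    for f :: "nat \<Rightarrow> 'a" and ks b
    by (induction ks) (simp_all add: mult.assoc)
  have fold_cong: "foldr (\<lambda>k. (*) (?m (X(j := a)) k)) ks u = foldr (\<lambda>k. (*) (?m X k)) ks u"
    if "k0 \<notin> set ks" for a ks
    using that by (induction ks) (auto simp: only)
  define L0 where "L0 = foldr (\<lambda>k. (*) (?m X k)) [0..<k0] u"
  define R0 where "R0 = foldr (\<lambda>k. (*) (?m X k)) [Suc k0..<N] u"
  have "foldr (\<lambda>k. (*) (?m X k)) ks u \<in> B" if "set ks \<subseteq> {..<N}" for ks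
    using that
  proof (induction ks)
    case (Cons k ks)
    moreover have "\<sigma> k < N" using Cons.prems permutes_in_image[OF \<sigma>] by auto
    ultimately show ?case by (auto intro!: B(2-5))
  qed (simp add: B(1))
  from this[of "[0..<k0]"] have L0: "L0 \<in> B" using k0(1) by (simp add: L0_def subset_iff)
  have "foldr (\<lambda>k a'. Y k * (X(j := a)) (\<sigma> k) * Z k * a') [0..<N] u = L0 * Y k0 * a * (Z k0 * R0)" for a
  proof -
    have "foldr (\<lambda>k a'. Y k * (X(j := a)) (\<sigma> k) * Z k * a') [0..<N] u
       = foldr (\<lambda>k. (*) (?m (X(j := a)) k)) [0..<k0] u
          * (?m (X(j := a)) k0 * foldr (\<lambda>k. (*) (?m (X(j := a)) k)) [Suc k0..<N] u)"
      unfolding list by (subst foldr_append, subst fold_mult) simp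
    also have "\<dots> = L0 * (?m (X(j := a)) k0 * R0)"
      by (subst (1 2) fold_cong) (auto simp: L0_def R0_def)
    finally show ?thesis using k0(2) by (simp add: mult.assoc)
  qed
  with L0 B k0(1) show ?thesis by blast
qed

lemma alternating_sum_linear:
  assumes j: "j < N" and fin: "finite I"
  shows "alternating_sum N Y Z (X(j := \<Sum>i\<in>I. scale (\<beta> i) (a i))) = (\<Sum>i\<in>I. scale (\<beta> i) (alternating_sum N Y Z (X(j := a i))))"
proof -
  let ?P = "\<lambda>\<sigma> b. foldr (\<lambda>k a'. Y k * (X(j := b)) (\<sigma> k) * Z k * a') [0..<N] u"
  have "?P \<sigma> (\<Sum>i\<in>I. scale (\<beta> i) (a i)) = (\<Sum>i\<in>I. scale (\<beta> i) (?P \<sigma> (a i)))" if \<sigma>: "\<sigma> permutes {..<N}" for \<sigma>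
  proof -
    obtain L R where "\<And>b. ?P \<sigma> b = L * b * R"
      using alternating_sum_slot[OF \<sigma> j, of UNIV Y Z X] by auto
    then show ?thesis
      by (simp add: sum_distrib_left sum_distrib_right mult_scale_left mult_scale_right)
  qed
  then have "alternating_sum N Y Z (X(j := \<Sum>i\<in>I. scale (\<beta> i) (a i)))
     = (\<Sum>\<sigma> | \<sigma> permutes {..<N}. \<Sum>i\<in>I. scale (\<beta> i) (scale (of_int (sign \<sigma>)) (?P \<sigma> (a i))))"
    unfolding alternating_sum_def by (intro sum.cong) (simp_all add: scale_sum_right mult.commute)
  also have "\<dots> = (\<Sum>i\<in>I. scale (\<beta> i) (alternating_sum N Y Z (X(j := a i))))"
    unfolding alternating_sum_def by (subst sum.swap) (simp add: scale_sum_right)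
  finally show ?thesis .
qed

text \<open>
  If a combination \<open>v\<close> of the alternating values, in which the \<open>j0\<close>-th one occurs, lies in
  \<open>W\<close>, then that value can be replaced by \<open>v\<close>: by linearity and alternation this multiplies the
  Capelli polynomial by the coefficient \<open>\<beta> j0\<close>. Afterwards every term has \<open>v\<close> as a factor, and the closure
  properties of \<open>W\<close> apply. Dimension arguments supply the combination.
\<close>

lemma capelli_value_mem:
  assumes W: "subspace W" "\<And>a b. a \<in> W \<Longrightarrow> a * b \<in> W" "\<And>a b. a \<in> B \<Longrightarrow> b \<in> W \<Longrightarrow> a * b \<in> W"
    and B: "u \<in> B" "\<And>a b. a \<in> B \<Longrightarrow> b \<in> B \<Longrightarrow> a * b \<in> B"
      "\<And>k. k < N \<Longrightarrow> s (x k) \<in> B" "\<And>k. k < N \<Longrightarrow> s (y k) \<in> B" "\<And>k. k < N \<Longrightarrow> s (z k) \<in> B"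
    and dep: "(\<Sum>j<N. scale (\<beta> j) (s (x j))) \<in> W" "j0 < N" "\<beta> j0 \<noteq> 0"
  shows "ev s (capelli N x y z) \<in> W"
proof -
  let ?X = "s \<circ> x" and ?Y = "s \<circ> y" and ?Z = "s \<circ> z"
  let ?b = "\<Sum>j<N. scale (\<beta> j) (?X j)"
  have "alternating_sum N ?Y ?Z (?X(j0 := ?b)) = (\<Sum>j<N. scale (\<beta> j) (alternating_sum N ?Y ?Z (?X(j0 := ?X j))))"
    by (rule alternating_sum_linear) (use dep in auto)
  also have "\<dots> = (\<Sum>j<N. if j = j0 then scale (\<beta> j0) (alternating_sum N ?Y ?Z ?X) else 0)"
  proof (intro sum.cong refl)
    fix j assume "j \<in> {..<N}"
    then show "scale (\<beta> j) (alternating_sum N ?Y ?Z (?X(j0 := ?X j)))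
        = (if j = j0 then scale (\<beta> j0) (alternating_sum N ?Y ?Z ?X) else 0)"
      using dep(2) alternating_sum_repeated[of j N j0 "?X(j0 := ?X j)" ?Y ?Z] fun_upd_triv[of ?X j0]
      by (cases "j = j0") auto
  qed
  also have "\<dots> = scale (\<beta> j0) (alternating_sum N ?Y ?Z ?X)" using dep(2) by simp
  finally have "alternating_sum N ?Y ?Z ?X = scale (1 / \<beta> j0) (alternating_sum N ?Y ?Z (?X(j0 := ?b)))"
    using dep(3) by simp
  moreover have "alternating_sum N ?Y ?Z (?X(j0 := ?b)) \<in> W"
    unfolding alternating_sum_def
  proof (intro subspace_sum W(1) subspace_scale)
    fix \<sigma> assume "\<sigma> \<in> {\<sigma>. \<sigma> permutes {..<N}}"
    then have "\<sigma> permutes {..<N}" by simp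
    then obtain L R where "L \<in> B"
      and "\<And>b. foldr (\<lambda>k a'. ?Y k * (?X(j0 := b)) (\<sigma> k) * ?Z k * a') [0..<N] u = L * b * R"
      using alternating_sum_slot[of \<sigma> N j0 B ?Y ?Z ?X] B dep(2) by auto
    with dep(1) show "foldr (\<lambda>k a'. ?Y k * (?X(j0 := ?b)) (\<sigma> k) * ?Z k * a') [0..<N] u \<in> W"
      using W(2,3) by simp
  qed
  ultimately show ?thesis
    by (simp add: ev_capelli alternating_sum_def subspace_scale[OF W(1)])
qed

end

section \<open>Polynomials in graded variables\<close>

lemma poly_vars_mult: "poly_vars (p * q) \<subseteq> poly_vars p \<union> poly_vars q"
proof
  fix v assume "v \<in> poly_vars (p * q)"
  then obtain w where "w \<in> Poly_Mapping.keys (p * q)" "v \<in> set (letters w)"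
    by (auto simp: poly_vars_def)
  with keys_mult[of p q] obtain a b where
    "a \<in> Poly_Mapping.keys p" "b \<in> Poly_Mapping.keys q" "v \<in> set (letters (a + b))" by blast
  then show "v \<in> poly_vars p \<union> poly_vars q" by (auto simp: poly_vars_def plus_fmon_def)
qed

lemma graded_polys_mult: "p \<in> graded_polys G \<Longrightarrow> q \<in> graded_polys G \<Longrightarrow> p * q \<in> graded_polys G"
  using poly_vars_mult[of p q] by (auto simp: graded_polys_def)

lemma (in monoid) word_degree_closed: "set w \<subseteq> UNIV \<times> carrier G \<Longrightarrow> word_degree G w \<in> carrier G"
  by (induction w) (auto simp: word_degree_def)

lemma (in monoid) word_degree_append:
  "set v \<subseteq> UNIV \<times> carrier G \<Longrightarrow> set w \<subseteq> UNIV \<times> carrier G \<Longrightarrow>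
    word_degree G (v @ w) = word_degree G v \<otimes> word_degree G w"
proof (induction v)
  case Nil
  then show ?case using word_degree_closed[of w] by (simp add: word_degree_def)
next
  case (Cons x v)
  have "word_degree G v \<in> carrier G" "word_degree G w \<in> carrier G" "snd x \<in> carrier G"
    using Cons.prems by (auto intro: word_degree_closed)
  moreover have "word_degree G (x # a) = snd x \<otimes> word_degree G a" for a :: "(nat \<times> 'a) list"
    by (simp add: word_degree_def)
  ultimately show ?case using Cons by (simp add: m_assoc)
qed

text \<open>
  Unlike \<^const>\<open>homogeneous\<close>, this records the degree, which has to be tracked along products.
\<close>

definition has_degree ::
    "('g, 'b) monoid_scheme \<Rightarrow> (nat \<times> 'g, 'f::field) free_alg \<Rightarrow> 'g \<Rightarrow> bool" where
  "has_degree G p g \<longleftrightarrow> g \<in> carrier G \<and> (\<forall>w\<in>Poly_Mapping.keys p. word_degree G (letters w) = g)"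

lemma homogeneous_iff: "homogeneous G p \<longleftrightarrow> (\<exists>g. has_degree G p g)"
  by (auto simp: homogeneous_def has_degree_def)

lemma (in monoid) has_degree_mult:
  assumes "p \<in> graded_polys G" "q \<in> graded_polys G" "has_degree G p g" "has_degree G q h"
  shows "has_degree G (p * q) (g \<otimes> h)"
proof -
  have "word_degree G (letters w) = g \<otimes> h" if "w \<in> Poly_Mapping.keys (p * q)" for w
  proof -
    from that keys_mult[of p q] obtain a b where
      ab: "a \<in> Poly_Mapping.keys p" "b \<in> Poly_Mapping.keys q" "w = a + b" by blast
    then have "set (letters a) \<subseteq> UNIV \<times> carrier G" "set (letters b) \<subseteq> UNIV \<times> carrier G"
      using assms(1,2) by (auto simp: graded_polys_def poly_vars_def)
    then show ?thesis using ab assms(3,4) by (simp add: plus_fmon_def word_degree_append has_degree_def)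
  qed
  then show ?thesis using assms(3,4) by (auto simp: has_degree_def)
qed

section \<open>Graded matrix algebras in coordinates\<close>

text \<open>
  The algebra $F^cH \otimes M_m(F)$ without reference to its realisation: \<open>E (h, i, j)\<close> is the image of
  $u_h \otimes e_{i,j}$ under the isomorphism of a presentation, and \<open>coef a\<close> is the coordinate
  vector of \<open>a\<close> in this basis.
\<close>

locale graded_matrix_model = comm_group G + graded_algebra G scale A
  for G :: "('g, 'b) monoid_scheme" (structure)
    and scale :: "'f::field_char_0 \<Rightarrow> 'a::ring \<Rightarrow> 'a"
    and A :: "'g \<Rightarrow> 'a set" +
  fixes H :: "'g set" and c :: "'g \<Rightarrow> 'g \<Rightarrow> 'f" and gs :: "'g list"
    and E :: "'g \<times> nat \<times> nat \<Rightarrow> 'a" and coef :: "'a \<Rightarrow> 'g \<times> nat \<times> nat \<Rightarrow> 'f"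
  assumes finite_carrier: "finite (carrier G)"
    and subgroup_H: "subgroup H G"
    and gs_subset: "set gs \<subseteq> carrier G"
    and gs_nonempty: "gs \<noteq> []"
    and cocycle: "c \<in> cocycles G H"
    and E_mult: "\<lbrakk>h \<in> H; h' \<in> H; i < length gs; j < length gs; i' < length gs; l < length gs\<rbrakk> \<Longrightarrow>
      E (h, i, j) * E (h', i', l) = (if j = i' then scale (c h h') (E (h \<otimes> h', i, l)) else 0)"
    and coef_add: "coef (a + b) k = coef a k + coef b k"
    and coef_scale: "coef (scale r a) k = r * coef a k"
    and coef_E: "k \<in> H \<times> {..<length gs} \<times> {..<length gs} \<Longrightarrow> coef (E k) k' = (if k' = k then 1 else 0)"
    and coef_nonzero: "coef a k \<noteq> 0 \<Longrightarrow> k \<in> H \<times> {..<length gs} \<times> {..<length gs}"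
    and expand: "a = (\<Sum>k\<in>H \<times> {..<length gs} \<times> {..<length gs}. scale (coef a k) (E k))"
    and component_iff: "g \<in> carrier G \<Longrightarrow>
      a \<in> A g \<longleftrightarrow> (\<forall>h i j. coef a (h, i, j) \<noteq> 0 \<longrightarrow> g = inv (gs ! i) \<otimes> h \<otimes> gs ! j)"
begin

abbreviation m where "m \<equiv> length gs"
abbreviation K where "K \<equiv> H \<times> {..<m} \<times> {..<m}"

lemma finite_H: "finite H"
  using subgroup.subset[OF subgroup_H] finite_carrier by (rule finite_subset)

lemma finite_K: "finite K" using finite_H by simp

lemma H_carrier [intro]: "h \<in> H \<Longrightarrow> h \<in> carrier G"
  using subgroup.subset[OF subgroup_H] by blast

lemma gs_carrier [intro, simp]: "i < m \<Longrightarrow> gs ! i \<in> carrier G"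
  using gs_subset nth_mem by blast

lemma H_closed [intro]:
  "\<one> \<in> H" "h \<in> H \<Longrightarrow> h' \<in> H \<Longrightarrow> h \<otimes> h' \<in> H" "h \<in> H \<Longrightarrow> inv h \<in> H"
  using subgroup_H by (auto intro: subgroup.one_closed subgroup.m_closed subgroup.m_inv_closed)

lemma c_nonzero: "h \<in> H \<Longrightarrow> h' \<in> H \<Longrightarrow> c h h' \<noteq> 0"
  using cocycle by (auto simp: cocycles_def)

lemma c_cocycle: "x \<in> H \<Longrightarrow> y \<in> H \<Longrightarrow> z \<in> H \<Longrightarrow> c x y * c (x \<otimes> y) z = c y z * c x (y \<otimes> z)"
  using cocycle by (auto simp: cocycles_def)

lemma c_one_left: "h \<in> H \<Longrightarrow> c \<one> h = c \<one> \<one>"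
  using c_cocycle[of \<one> \<one> h] c_nonzero[of \<one> h] by (simp add: H_carrier H_closed)

lemma c_one_right: "h \<in> H \<Longrightarrow> c h \<one> = c \<one> \<one>"
  using c_cocycle[of h \<one> \<one>] c_nonzero[of h \<one>] by (simp add: H_carrier H_closed)

lemma c_inverse_commute: "h \<in> H \<Longrightarrow> c h (inv h) = c (inv h) h"
  using c_cocycle[of h "inv h" h] c_one_left[of h] c_one_right[of h] c_nonzero[of \<one> \<one>]
  by (simp add: H_carrier H_closed)

lemma coef_zero [simp]: "coef 0 k = 0"
  using coef_scale[of 0 0 k] by simp

lemma coef_sum: "coef (\<Sum>i\<in>I. f i) k = (\<Sum>i\<in>I. coef (f i) k)"
  by (induction I rule: infinite_finite_induct) (simp_all add: coef_add)

lemma eq_zero_if_coef: "(\<And>k. k \<in> K \<Longrightarrow> coef a k = 0) \<Longrightarrow> a = 0"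
  by (subst expand) simp

lemma nonzero_coef: "a \<noteq> 0 \<Longrightarrow> \<exists>h i j. coef a (h, i, j) \<noteq> 0 \<and> h \<in> H \<and> i < m \<and> j < m"
  using eq_zero_if_coef[of a] by fastforce

lemma E_nonzero: "k \<in> K \<Longrightarrow> E k \<noteq> 0"
  using coef_E[of k k] by auto

lemma cancel_inv [simp]:
  assumes "x \<in> carrier G" "y \<in> carrier G"
  shows "x \<otimes> (inv x \<otimes> y) = y" "inv x \<otimes> (x \<otimes> y) = y"
  using assms by (simp_all flip: m_assoc)

lemma degree_iff:
  assumes "g \<in> carrier G" "h \<in> carrier G" "i < m" "j < m"
  shows "g = inv (gs ! i) \<otimes> h \<otimes> gs ! j \<longleftrightarrow> h = gs ! i \<otimes> g \<otimes> inv (gs ! j)"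
  using assms by (auto simp: m_assoc)

lemma E_component:
  assumes "g \<in> carrier G" "h \<in> H" "i < m" "j < m" "h = gs ! i \<otimes> g \<otimes> inv (gs ! j)"
  shows "E (h, i, j) \<in> A g"
  using assms degree_iff[of g h i j] by (auto simp: component_iff coef_E H_carrier)

text \<open>
  A homogeneous element has at most one nonzero coordinate in each matrix position, since its degree and the position
  determine the element of \<open>H\<close>. This is what makes up for zero divisors in the twisted group
  algebra.
\<close>

lemma component_coef:
  assumes "a \<in> A g" "g \<in> carrier G" "coef a (h, i, j) \<noteq> 0"
  shows "h \<in> H" "i < m" "j < m" "h = gs ! i \<otimes> g \<otimes> inv (gs ! j)"
  using assms coef_nonzero[OF assms(3)] degree_iff[of g h i j]
  by (auto simp: component_iff)

lemma coef_mult_support: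
  assumes "coef (a * b) (h, i, j) \<noteq> 0"
  shows "\<exists>l h1 h2. coef a (h1, i, l) \<noteq> 0 \<and> coef b (h2, l, j) \<noteq> 0"
proof -
  have "a * b = (\<Sum>k\<in>K. scale (coef a k) (E k)) * (\<Sum>k\<in>K. scale (coef b k) (E k))"
    by (simp flip: expand)
  also have "\<dots> = (\<Sum>k\<in>K. \<Sum>k'\<in>K. scale (coef a k * coef b k') (E k * E k'))"
    by (simp add: sum_product scale_mult_left scale_mult_right mult.commute)
  finally have "(\<Sum>k\<in>K. \<Sum>k'\<in>K. coef a k * coef b k' * coef (E k * E k') (h, i, j)) \<noteq> 0"
    using assms by (simp add: coef_sum coef_scale)
  then obtain k k' where k: "k \<in> K" "k' \<in> K" "coef a k * coef b k' * coef (E k * E k') (h, i, j) \<noteq> 0"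
    by (metis (no_types, lifting) sum.neutral)
  obtain h1 i1 l1 h2 l2 j2 where kk: "k = (h1, i1, l1)" "k' = (h2, l2, j2)"
    by (metis surj_pair)
  have "h1 \<otimes> h2 \<in> H" using k kk by auto
  then have "l1 = l2 \<and> i1 = i \<and> j2 = j"
    using k unfolding kk by (auto simp: E_mult coef_scale coef_E split: if_splits)
  then show ?thesis using k(3) unfolding kk by auto
qed

text \<open>
  Multiplication by basis elements from both sides cuts a homogeneous element down to its coordinate
  in position \<open>(i, j)\<close> and moves it to position \<open>(p, q)\<close>.
\<close>

lemma sandwich:
  assumes a: "a \<in> A g" "g \<in> carrier G" "coef a (h0, i, j) \<noteq> 0"
    and hp: "h \<in> H" "h' \<in> H" "p < m" "q < m"
  shows "\<exists>r. r \<noteq> 0 \<and> E (h, p, i) * a * E (h', j, q) = scale r (E (h \<otimes> h0 \<otimes> h', p, q))"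
proof -
  note 0 = component_coef[OF a]
  let ?t = "\<lambda>k. scale (coef a k) (E (h, p, i) * E k * E (h', j, q))"
  have "E (h, p, i) * a * E (h', j, q) = E (h, p, i) * (\<Sum>k\<in>K. scale (coef a k) (E k)) * E (h', j, q)"
    by (simp flip: expand)
  also have "\<dots> = (\<Sum>k\<in>K. ?t k)"
    by (simp add: sum_distrib_left sum_distrib_right scale_mult_left scale_mult_right)
  also have "\<dots> = (\<Sum>k\<in>{(h0, i, j)}. ?t k)"
  proof (rule sum.mono_neutral_right)
    show "\<forall>k\<in>K - {(h0, i, j)}. ?t k = 0"
    proof
      fix k assume k: "k \<in> K - {(h0, i, j)}"
      obtain h1 i1 j1 where kk: "k = (h1, i1, j1)" by (metis surj_pair)
      have "h1 = gs ! i1 \<otimes> g \<otimes> inv (gs ! j1)" if "coef a k \<noteq> 0"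
        using component_coef(4)[OF a(1,2)] that kk by blast
      then have "coef a k = 0 \<or> i1 \<noteq> i \<or> j1 \<noteq> j"
        using k 0(4) unfolding kk by auto
      then show "?t k = 0"
        using k hp 0 unfolding kk by (auto simp: E_mult scale_mult_left H_closed)
    qed
  qed (use 0 finite_K in auto)
  also have "\<dots> = scale (coef a (h0, i, j) * (c h h0 * c (h \<otimes> h0) h')) (E (h \<otimes> h0 \<otimes> h', p, q))"
    using hp 0(1-3) by (simp add: E_mult scale_mult_left H_closed)
  finally show ?thesis
    using a(3) c_nonzero[of h h0] c_nonzero[of "h \<otimes> h0" h'] hp 0(1)
    by (intro exI[of _ "coef a (h0, i, j) * (c h h0 * c (h \<otimes> h0) h')"]) (simp add: H_closed)
qed

definition u :: 'a where "u = (\<Sum>i<m. scale (1 / c \<one> \<one>) (E (\<one>, i, i)))"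

lemma u_mult_E: "k \<in> K \<Longrightarrow> u * E k = E k"
proof -
  assume k: "k \<in> K"
  obtain h i j where kk: "k = (h, i, j)" by (metis surj_pair)
  have "u * E k = (\<Sum>i'<m. if i' = i then E k else 0)"
    unfolding u_def sum_distrib_right
    using k c_nonzero[of \<one> \<one>] c_one_left[of h] unfolding kk
    by (intro sum.cong) (auto simp: scale_mult_left E_mult H_closed H_carrier)
  then show ?thesis using k kk by simp
qed

lemma E_mult_u: "k \<in> K \<Longrightarrow> E k * u = E k"
proof -
  assume k: "k \<in> K"
  obtain h i j where kk: "k = (h, i, j)" by (metis surj_pair)
  have "E k * u = (\<Sum>i'<m. if i' = j then E k else 0)"
    unfolding u_def sum_distrib_left
    using k c_nonzero[of \<one> \<one>] c_one_right[of h] unfolding kk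
    by (intro sum.cong) (auto simp: scale_mult_right E_mult H_closed H_carrier)
  then show ?thesis using k kk by simp
qed

sublocale char_0_unital_algebra scale u
proof
  fix x y :: 'a and r
  show "scale r x * y = scale r (x * y)" by (rule scale_mult_left)
  show "x * scale r y = scale r (x * y)" by (rule scale_mult_right)
  have "u * x = u * (\<Sum>k\<in>K. scale (coef x k) (E k))" by (simp flip: expand)
  also have "\<dots> = (\<Sum>k\<in>K. scale (coef x k) (E k))"
    unfolding sum_distrib_left by (intro sum.cong) (simp_all add: scale_mult_right u_mult_E)
  finally show ux: "u * x = x" by (simp flip: expand)
  have "x * u = (\<Sum>k\<in>K. scale (coef x k) (E k)) * u" by (simp flip: expand)
  also have "\<dots> = (\<Sum>k\<in>K. scale (coef x k) (E k))"
    unfolding sum_distrib_right by (intro sum.cong) (simp_all add: scale_mult_left E_mult_u)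
  finally show "x * u = x" by (simp flip: expand)
  have "(\<one>, 0, 0) \<in> K" using gs_nonempty by (auto simp: H_closed)
  with u_mult_E E_nonzero show "u \<noteq> 0" by fastforce
qed

lemma zero_component: "g \<in> carrier G \<Longrightarrow> 0 \<in> A g"
  by (simp add: component_iff)

lemma sum_scale_component:
  "g \<in> carrier G \<Longrightarrow> (\<And>i. i \<in> I \<Longrightarrow> f i \<in> A g) \<Longrightarrow> (\<Sum>i\<in>I. scale (r i) (f i)) \<in> A g"
  using subspace_component[of g] by (intro subspace_sum subspace_scale)

lemma u_component: "u \<in> A \<one>"
  unfolding u_def by (intro sum_scale_component E_component) (auto simp: H_closed)

definition graded_subst :: "(nat \<times> 'g \<Rightarrow> 'a) \<Rightarrow> bool" where
  "graded_subst s \<longleftrightarrow> (\<forall>i. \<forall>g\<in>carrier G. s (i, g) \<in> A g)"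

lemma graded_ids_iff:
  assumes "p \<in> graded_polys G"
  shows "p \<in> graded_ids G scale A \<longleftrightarrow> (\<forall>s. graded_subst s \<longrightarrow> ev s p = 0)"
proof -
  have "graded_subst (\<lambda>_. 0)" by (simp add: graded_subst_def zero_component)
  then show ?thesis
    using assms lookup_zero_if_ev_at_zero[of p]
    by (auto simp: graded_ids_def graded_subst_def vanishes_at_iff)
qed

lemma wv_component:
  "graded_subst s \<Longrightarrow> set w \<subseteq> UNIV \<times> carrier G \<Longrightarrow> wv s w \<in> A (word_degree G w)"
proof (induction w)
  case (Cons x w)
  then show ?case
    using components_mult[of "snd x" "word_degree G w" "s x" "wv s w"] word_degree_closed[of w]
    by (cases x) (auto simp: word_degree_def graded_subst_def)
qed (simp add: word_degree_def u_component)

lemma ev_component: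
  assumes "graded_subst s" "p \<in> graded_polys G"
    and "has_degree G p g"
  shows "ev s p \<in> A g"
  unfolding ev_def
proof (rule sum_scale_component)
  show "g \<in> carrier G" using assms(3) by (simp add: has_degree_def)
  fix w assume w: "w \<in> Poly_Mapping.keys p"
  then have "set (letters w) \<subseteq> UNIV \<times> carrier G"
    using assms(2) by (auto simp: graded_polys_def poly_vars_def)
  from wv_component[OF assms(1) this] assms(3) w show "wv s (letters w) \<in> A g"
    by (simp add: has_degree_def)
qed

text \<open>
  A Capelli polynomial with more alternating variables than the dimension vanishes, as their values
  are linearly dependent. All three families of variables may coincide, since
  \<open>capelli_nonzero\<close> asks for injectivity of \<open>x\<close> alone.
\<close>

lemma satisfies_polynomial_identity: "PI_algebra scale"
proof -
  let ?N = "Suc (card K)" and ?id = "\<lambda>k::nat. k"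
  let ?f = "capelli ?N ?id ?id ?id :: (nat, 'f) free_alg"
  have "ev s ?f = 0" for s
  proof -
    obtain \<beta> j where \<beta>: "j < ?N" "\<beta> j \<noteq> 0" "\<And>k. k \<in> K \<Longrightarrow> (\<Sum>j<?N. \<beta> j * coef (s j) k) = 0"
      using linear_system_nontrivial_solution[of K "{..<?N}" "\<lambda>j. coef (s j)"] finite_K by auto
    have "(\<Sum>j<?N. scale (\<beta> j) (s j)) = 0"
      by (rule eq_zero_if_coef) (use \<beta>(3) in \<open>simp only: coef_sum coef_scale\<close>)
    then have "ev s ?f \<in> {0}"
      by (intro capelli_value_mem[where B = UNIV and \<beta> = \<beta> and ?j0.0 = j])
        (use \<beta> in \<open>auto simp: subspace_single_0\<close>)
    then show ?thesis by simp
  qed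
  moreover from this have "Poly_Mapping.lookup ?f 0 = 0" by (rule lookup_zero_if_ev_at_zero)
  moreover have "?f \<noteq> 0" by (rule capelli_nonzero) simp
  ultimately show ?thesis by (auto simp: PI_algebra_def vanishes_at_iff)
qed

end

section \<open>Equal representation implies strong verbal primeness\<close>

context graded_matrix_model
begin

definition coset_count :: "'g \<Rightarrow> nat" where
  "coset_count x = card {i. i < m \<and> gs ! i \<in> H #> x}"

lemma rcoset_iff: "x \<in> carrier G \<Longrightarrow> y \<in> carrier G \<Longrightarrow> y \<in> H #> x \<longleftrightarrow> y \<otimes> inv x \<in> H"
  using subgroup.rcos_module[OF subgroup_H is_group, of x y]
  by simp

lemma rcoset_eq_iff: "x \<in> carrier G \<Longrightarrow> y \<in> carrier G \<Longrightarrow> H #> y = H #> x \<longleftrightarrow> y \<otimes> inv x \<in> H"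
  by (metis repr_independence rcos_self rcoset_iff subgroup_H)

text \<open>
  Translation by \<open>g\<close> permutes the cosets. The rows of \<open>C\<close> and of \<open>C #> g\<close> are equally many, so
  bijections between them can be glued to a permutation of all rows. The prescribed
  value \<open>k\<close> at \<open>j\<close> is reached by a final transposition inside one coset.
\<close>

lemma coset_shift_permutation:
  assumes const: "\<And>x y. x \<in> carrier G \<Longrightarrow> y \<in> carrier G \<Longrightarrow> coset_count x = coset_count y"
    and jk: "j < m" "k < m" "g \<in> carrier G" "gs ! j \<otimes> g \<otimes> inv (gs ! k) \<in> H"
  shows "\<exists>\<sigma>. bij_betw \<sigma> {..<m} {..<m} \<and> \<sigma> j = k \<and> (\<forall>i<m. gs ! i \<otimes> g \<otimes> inv (gs ! \<sigma> i) \<in> H)"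
proof -
  let ?I = "\<lambda>C. {i. i < m \<and> gs ! i \<in> C}"
  have "\<forall>C\<in>(\<lambda>x. H #> x) ` carrier G. \<exists>\<beta>. bij_betw \<beta> (?I C) (?I (C #> g))"
  proof
    fix C assume "C \<in> (\<lambda>x. H #> x) ` carrier G"
    then obtain x where x: "x \<in> carrier G" "C = H #> x" by blast
    then have "C #> g = H #> (x \<otimes> g)"
      using jk(3) subgroup.subset[OF subgroup_H] by (simp add: coset_mult_assoc)
    then have "card (?I C) = card (?I (C #> g))"
      using const[of x "x \<otimes> g"] x jk(3) by (simp add: coset_count_def)
    then show "\<exists>\<beta>. bij_betw \<beta> (?I C) (?I (C #> g))" by (intro finite_same_card_bij) auto
  qed
  then obtain \<beta> where "\<forall>C\<in>(\<lambda>x. H #> x) ` carrier G. bij_betw (\<beta> C) (?I C) (?I (C #> g))"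
    by (rule bchoice[THEN exE])
  then have \<beta>: "bij_betw (\<beta> (H #> x)) (?I (H #> x)) (?I (H #> x #> g))" if "x \<in> carrier G" for x
    by (rule bspec) (use that in simp)
  define \<sigma>0 where "\<sigma>0 i = \<beta> (H #> gs ! i) i" for i
  have assoc: "H #> x #> g = H #> (x \<otimes> g)" if "x \<in> carrier G" for x
    using that jk(3) subgroup.subset[OF subgroup_H] by (simp add: coset_mult_assoc)
  have \<sigma>0: "\<sigma>0 i < m" "H #> gs ! \<sigma>0 i = H #> (gs ! i \<otimes> g)" if i: "i < m" for i
  proof -
    have "i \<in> ?I (H #> gs ! i)" using i subgroup_H by (auto intro: rcos_self)
    with i have "\<sigma>0 i \<in> ?I (H #> gs ! i #> g)"
      unfolding \<sigma>0_def by (intro bij_betw_apply[OF \<beta>]) simp_all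
    with i have "\<sigma>0 i \<in> ?I (H #> (gs ! i \<otimes> g))" by (simp add: assoc)
    then show "\<sigma>0 i < m" "H #> gs ! \<sigma>0 i = H #> (gs ! i \<otimes> g)"
      using i jk(3) by (auto simp: rcoset_eq_iff rcoset_iff)
  qed
  have inj: "inj_on \<sigma>0 {..<m}"
  proof (rule inj_onI)
    fix i i' assume i: "i \<in> {..<m}" "i' \<in> {..<m}" "\<sigma>0 i = \<sigma>0 i'"
    then have "H #> (gs ! i \<otimes> g) = H #> (gs ! i' \<otimes> g)" using \<sigma>0 by (metis lessThan_iff)
    then have "H #> gs ! i = H #> gs ! i'"
      using i jk(3) by (simp add: rcoset_eq_iff inv_mult_group m_assoc)
    moreover have "i \<in> ?I (H #> gs ! i)" "i' \<in> ?I (H #> gs ! i')"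
      using i subgroup_H by (auto intro: rcos_self)
    ultimately show "i = i'"
      using inj_onD[OF bij_betw_imp_inj_on[OF \<beta>, of "gs ! i"], of i i'] i by (simp add: \<sigma>0_def)
  qed
  define \<sigma> where "\<sigma> = transpose (\<sigma>0 j) k \<circ> \<sigma>0"
  have coset_k: "H #> gs ! k = H #> gs ! \<sigma>0 j"
    using jk \<sigma>0(2)[OF jk(1)] by (metis gs_carrier m_closed rcoset_eq_iff)
  have \<sigma>: "\<sigma> i < m" "H #> gs ! \<sigma> i = H #> gs ! \<sigma>0 i" if "i < m" for i
    using \<sigma>0(1)[OF that] \<sigma>0(1)[OF jk(1)] jk(2) coset_k by (auto simp: \<sigma>_def transpose_def)
  have "inj_on \<sigma> {..<m}"
    unfolding \<sigma>_def by (rule comp_inj_on[OF inj]) (rule inj_on_subset[OF inj_transpose], simp)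
  then have "bij_betw \<sigma> {..<m} {..<m}"
    unfolding bij_betw_def using \<sigma>(1) by (intro conjI endo_inj_surj) auto
  moreover have "\<sigma> j = k" by (simp add: \<sigma>_def)
  moreover have "gs ! i \<otimes> g \<otimes> inv (gs ! \<sigma> i) \<in> H" if i: "i < m" for i
    using \<sigma>[OF i] \<sigma>0[OF i] i jk(3) by (metis gs_carrier m_closed rcoset_eq_iff)
  ultimately show ?thesis by blast
qed

definition invertible_pair :: "'g \<Rightarrow> 'a \<Rightarrow> 'a \<Rightarrow> bool" where
  "invertible_pair g X W \<longleftrightarrow> X \<in> A g \<and> W \<in> A (inv g) \<and> X * W = u \<and> W * X = u"

text \<open>
  A monomial matrix along \<open>\<sigma>\<close> is inverted by the transposed pattern with inverted entries. The
  same scalars work on both sides because \<open>c h (inv h) = c (inv h) h\<close>.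
\<close>

lemma monomial_invertible:
  assumes \<sigma>: "bij_betw \<sigma> {..<m} {..<m}" and g: "g \<in> carrier G"
    and H: "\<And>i. i < m \<Longrightarrow> gs ! i \<otimes> g \<otimes> inv (gs ! \<sigma> i) \<in> H"
    and r: "\<And>i. i < m \<Longrightarrow> r i \<noteq> 0"
  shows "\<exists>W. invertible_pair g (\<Sum>i<m. scale (r i) (E (gs ! i \<otimes> g \<otimes> inv (gs ! \<sigma> i), i, \<sigma> i))) W"
proof -
  define h where "h i = gs ! i \<otimes> g \<otimes> inv (gs ! \<sigma> i)" for i
  define t where "t i = 1 / (r i * c (h i) (inv (h i)) * c \<one> \<one>)" for i
  have h: "h i \<in> H" "h i \<in> carrier G" "inv (h i) \<in> H" "inv (h i) \<in> carrier G" if "i < m" for i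
    using H[OF that] by (auto simp: h_def)
  have \<sigma>m: "\<sigma> i < m" if "i < m" for i using \<sigma> that by (auto simp: bij_betw_def)
  have \<sigma>_inj: "\<sigma> i = \<sigma> j \<longleftrightarrow> i = j" if "i < m" "j < m" for i j
    using \<sigma> that by (auto simp: bij_betw_def inj_on_def)
  have one: "\<one> \<in> H" by (rule H_closed)
  let ?X = "\<Sum>i<m. scale (r i) (E (h i, i, \<sigma> i))"
  let ?W = "\<Sum>i<m. scale (t i) (E (inv (h i), \<sigma> i, i))"
  have rt: "r i * (t i * c (h i) (inv (h i))) = 1 / c \<one> \<one>"
    "t i * r i * c (h i) (inv (h i)) = 1 / c \<one> \<one>"
    "r i * t i * c (h i) (inv (h i)) = 1 / c \<one> \<one>" if "i < m" for i
    using r[OF that] c_nonzero h[OF that] by (simp_all add: t_def)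
  have XW: "E (h i, i, \<sigma> i) * E (inv (h j), \<sigma> j, j)
      = (if i = j then scale (c (h i) (inv (h i))) (E (\<one>, i, i)) else 0)" if "i < m" "j < m" for i j
    using that h \<sigma>m \<sigma>_inj by (simp add: E_mult)
  have WX: "E (inv (h i), \<sigma> i, i) * E (h j, j, \<sigma> j)
      = (if i = j then scale (c (h i) (inv (h i))) (E (\<one>, \<sigma> i, \<sigma> i)) else 0)" if "i < m" "j < m" for i j
    using that h \<sigma>m by (simp add: E_mult c_inverse_commute)
  have "?X * ?W = (\<Sum>i<m. \<Sum>j<m. if i = j then scale (1 / c \<one> \<one>) (E (\<one>, i, i)) else 0)"
    unfolding sum_product
    by (intro sum.cong refl) (use XW rt in \<open>auto simp: scale_mult_left scale_mult_right\<close>)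
  also have "\<dots> = u" by (simp add: u_def)
  finally have XW: "?X * ?W = u" .
  have "?W * ?X = (\<Sum>i<m. \<Sum>j<m. if i = j then scale (1 / c \<one> \<one>) (E (\<one>, \<sigma> i, \<sigma> i)) else 0)"
    unfolding sum_product
    by (intro sum.cong refl) (use WX rt in \<open>auto simp: scale_mult_left scale_mult_right mult.left_commute\<close>)
  also have "\<dots> = (\<Sum>i<m. scale (1 / c \<one> \<one>) (E (\<one>, \<sigma> i, \<sigma> i)))" by simp
  also have "\<dots> = u"
    unfolding u_def by (rule sum.reindex_bij_betw[OF \<sigma>, of "\<lambda>i. scale (1 / c \<one> \<one>) (E (\<one>, i, i))"])
  finally have WX: "?W * ?X = u" .
  have "?X \<in> A g"
    by (intro sum_scale_component g E_component) (use h \<sigma>m in \<open>auto simp: h_def\<close>)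
  moreover have "?W \<in> A (inv g)"
  proof (intro sum_scale_component E_component inv_closed g)
    fix i assume "i \<in> {..<m}"
    then have i: "i < m" by simp
    show "inv (h i) = gs ! \<sigma> i \<otimes> inv g \<otimes> inv (gs ! i)"
      using i \<sigma>m[OF i] g by (simp add: h_def inv_mult_group m_ac)
  qed (use h \<sigma>m in auto)
  ultimately show ?thesis using XW WX unfolding invertible_pair_def h_def by blast
qed

text \<open>
  Two monomial matrices which differ in a single entry differ by a multiple of the basis element at
  that entry, and both are invertible.
\<close>

lemma annihilator_of_invertibles_kills_E:
  assumes const: "\<And>x y. x \<in> carrier G \<Longrightarrow> y \<in> carrier G \<Longrightarrow> coset_count x = coset_count y"
    and ann: "\<And>g X W. g \<in> carrier G \<Longrightarrow> invertible_pair g X W \<Longrightarrow> a * X * b = 0"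
    and jk: "h \<in> H" "j < m" "k < m"
  shows "a * E (h, j, k) * b = 0"
proof -
  define g where "g = inv (gs ! j) \<otimes> h \<otimes> gs ! k"
  have g: "g \<in> carrier G" using jk by (auto simp: g_def)
  have h: "h = gs ! j \<otimes> g \<otimes> inv (gs ! k)"
    using degree_iff[of g h j k] g jk by (auto simp: g_def)
  obtain \<sigma> where \<sigma>: "bij_betw \<sigma> {..<m} {..<m}" "\<sigma> j = k"
    "\<And>i. i < m \<Longrightarrow> gs ! i \<otimes> g \<otimes> inv (gs ! \<sigma> i) \<in> H"
    using coset_shift_permutation[OF const jk(2,3) g] jk(1) h by auto
  let ?e = "\<lambda>i. E (gs ! i \<otimes> g \<otimes> inv (gs ! \<sigma> i), i, \<sigma> i)"
  have zero: "a * (\<Sum>i<m. scale (r i) (?e i)) * b = 0" if r: "\<And>i. i < m \<Longrightarrow> r i \<noteq> 0" for r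
  proof -
    obtain W where "invertible_pair g (\<Sum>i<m. scale (r i) (?e i)) W"
      using monomial_invertible[OF \<sigma>(1) g, of r] \<sigma>(3) r by blast
    then show ?thesis by (rule ann[OF g])
  qed
  \<comment> \<open>The entry at \<open>j\<close> is \<open>2\<close> in one matrix and \<open>1\<close> in the other; both are nonzero and differ by \<open>1\<close>.\<close>
  let ?r = "\<lambda>i. if i = j then 2 else (1::'f)"
  have "E (h, j, k) = (\<Sum>i<m. scale (?r i - 1) (?e i))"
  proof -
    have "(\<Sum>i<m. scale (?r i - 1) (?e i)) = (\<Sum>i<m. if i = j then E (h, j, k) else 0)"
      using \<sigma>(2) by (intro sum.cong) (auto simp flip: h)
    then show ?thesis using jk(2) by simp
  qed
  also have "\<dots> = (\<Sum>i<m. scale (?r i) (?e i)) - (\<Sum>i<m. scale 1 (?e i))"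
    by (simp add: scale_left_diff_distrib sum_subtractf)
  finally have "a * E (h, j, k) * b
      = a * (\<Sum>i<m. scale (?r i) (?e i)) * b - a * (\<Sum>i<m. scale 1 (?e i)) * b"
    by (simp only: left_diff_distrib right_diff_distrib)
  then show ?thesis using zero[of ?r] zero[of "\<lambda>_. 1"] by simp
qed

lemma ev_conjugate:
  assumes "W * X = u" "X * W = u"
  shows "ev (\<lambda>v. X * s v * W) p = X * ev s p * W"
proof -
  have cancel: "W * (X * a) = a" for a by (metis assms(1) mult.assoc unit_left)
  have "wv (\<lambda>v. X * s v * W) w = X * wv s w * W" for w
  proof (induction w)
    case (Cons v w)
    then show ?case by (simp add: mult.assoc cancel)
  qed (simp add: assms)
  then show ?thesis
    by (simp add: ev_def sum_distrib_left sum_distrib_right scale_mult_left scale_mult_right)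
qed

lemma strongly_verbally_prime_if_equal_coset_counts:
  assumes const: "\<And>x y. x \<in> carrier G \<Longrightarrow> y \<in> carrier G \<Longrightarrow> coset_count x = coset_count y"
  shows "strongly_verbally_prime G scale A"
  unfolding strongly_verbally_prime_def
proof (intro conjI satisfies_polynomial_identity ballI impI)
  fix p q :: "(nat \<times> 'g, 'f) free_alg"
  assume p: "p \<in> graded_polys G" "homogeneous G p" and q: "q \<in> graded_polys G" "homogeneous G q"
    and disj: "poly_vars p \<inter> poly_vars q = {}" and pq: "p * q \<in> graded_ids G scale A"
  show "p \<in> graded_ids G scale A \<or> q \<in> graded_ids G scale A"
  proof (rule ccontr)
    assume "\<not> ?thesis"
    then obtain s t where s: "graded_subst s" "ev s p \<noteq> 0" and t: "graded_subst t" "ev t q \<noteq> 0"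
      using graded_ids_iff p(1) q(1) by blast
    let ?a = "ev s p" and ?b = "ev t q"
    have ann: "?a * X * ?b = 0" if g: "g \<in> carrier G" and "invertible_pair g X W" for g X W
    proof -
      from that have XW: "X \<in> A g" "W \<in> A (inv g)" "X * W = u" "W * X = u"
        by (simp_all add: invertible_pair_def)
      \<comment> \<open>Conjugating the values for the variables of \<open>q\<close> yields another graded substitution, because \<open>G\<close> is abelian.\<close>
      define s' where "s' v = (if v \<in> poly_vars p then s v else X * t v * W)" for v
      have "X * t (i, x) * W \<in> A x" if x: "x \<in> carrier G" for i x
      proof -
        have "X * t (i, x) * W \<in> A (g \<otimes> x \<otimes> inv g)"
          using t(1) x g XW by (intro components_mult) (auto simp: graded_subst_def)
        moreover have "g \<otimes> x \<otimes> inv g = x" using x g by (simp add: m_comm[of g x] m_assoc)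
        ultimately show ?thesis by simp
      qed
      then have "graded_subst s'" using s(1) by (simp add: graded_subst_def s'_def)
      then have "ev s' (p * q) = 0"
        using pq graded_ids_iff graded_polys_mult p(1) q(1) by blast
      moreover have "ev s' p = ?a" by (rule ev_cong) (simp add: s'_def)
      moreover have "ev s' q = ev (\<lambda>v. X * t v * W) q"
        by (rule ev_cong) (use disj in \<open>auto simp: s'_def\<close>)
      ultimately have "?a * (X * ?b * W) = 0"
        by (simp add: ev_mult ev_conjugate[OF XW(4,3)])
      then have "?a * (X * ?b * W) * X = 0" by simp
      then show ?thesis using XW(4) by (simp add: mult.assoc)
    qed
    have kill: "?a * E (h, j, k) * ?b = 0" if "h \<in> H" "j < m" "k < m" for h j k
      by (rule annihilator_of_invertibles_kills_E[OF const ann that])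
    \<comment> \<open>Position \<open>(i, j)\<close> of the first value and position \<open>(k, l)\<close> of the second are linked by \<open>E (\<one>, j, k)\<close>.\<close>
    obtain d where d: "d \<in> carrier G" "?a \<in> A d"
      using p s(1) by (meson ev_component has_degree_def homogeneous_iff)
    obtain e where e: "e \<in> carrier G" "?b \<in> A e"
      using q t(1) by (meson ev_component has_degree_def homogeneous_iff)
    obtain h i j where a: "coef ?a (h, i, j) \<noteq> 0" "h \<in> H" "i < m" "j < m"
      using nonzero_coef[OF s(2)] by blast
    obtain h' k l where b: "coef ?b (h', k, l) \<noteq> 0" "h' \<in> H" "k < m" "l < m"
      using nonzero_coef[OF t(2)] by blast
    have one: "\<one> \<in> H" by (rule H_closed)
    obtain r where r: "r \<noteq> 0" "E (\<one>, i, i) * ?a * E (\<one>, j, k) = scale r (E (\<one> \<otimes> h \<otimes> \<one>, i, k))"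
      using sandwich[OF d(2,1) a(1) one one a(3) b(3)] by blast
    have hH: "\<one> \<otimes> h \<otimes> \<one> \<in> H" using a(2) by auto
    obtain r' where r': "r' \<noteq> 0" "E (\<one> \<otimes> h \<otimes> \<one>, i, k) * ?b * E (\<one>, l, l)
        = scale r' (E (\<one> \<otimes> h \<otimes> \<one> \<otimes> h' \<otimes> \<one>, i, l))"
      using sandwich[OF e(2,1) b(1) hH one a(3) b(4)] by blast
    have "E (\<one>, i, i) * (?a * E (\<one>, j, k) * ?b) * E (\<one>, l, l)
        = scale r (scale r' (E (\<one> \<otimes> h \<otimes> \<one> \<otimes> h' \<otimes> \<one>, i, l)))"
      using r(2) r'(2) by (simp add: mult.assoc[symmetric] scale_mult_left)
    moreover have "(\<one> \<otimes> h \<otimes> \<one> \<otimes> h' \<otimes> \<one>, i, l) \<in> K" using a b by (auto simp: H_closed)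
    ultimately show False
      using kill[OF one a(4) b(3)] r(1) r'(1) E_nonzero by auto
  qed
qed

end

section \<open>Strong verbal primeness implies equal representation\<close>

context graded_matrix_model
begin

lemma graded_polys_single:
  "g \<in> carrier G \<Longrightarrow> Poly_Mapping.single (Word [(n, g)]) (1::'f) \<in> graded_polys G"
  by (simp add: graded_polys_def poly_vars_def)

lemma has_degree_single:
  "g \<in> carrier G \<Longrightarrow> has_degree G (Poly_Mapping.single (Word [(n, g)]) (1::'f)) g"
  by (simp add: has_degree_def word_degree_def)

lemma monomial_not_identity:
  assumes "g \<in> carrier G" "A g \<noteq> {0}"
  shows "Poly_Mapping.single (Word [(n, g)]) 1 \<notin> graded_ids G scale A"
proof -
  obtain a where a: "a \<in> A g" "a \<noteq> 0"
    using assms zero_component[of g] by blast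
  define s where "s v = (if snd v = g then a else 0)" for v :: "nat \<times> 'g"
  have "graded_subst s" using a zero_component by (simp add: graded_subst_def s_def)
  moreover have "ev s (Poly_Mapping.single (Word [(n, g)]) 1) \<noteq> 0" using a by (simp add: s_def)
  ultimately show ?thesis using graded_ids_iff graded_polys_single[OF assms(1)] by blast
qed

lemma product_not_identity:
  assumes "strongly_verbally_prime G scale A"
    and "p \<in> graded_polys G" "q \<in> graded_polys G" "has_degree G p g" "has_degree G q h"
    and "poly_vars p \<inter> poly_vars q = {}" "p \<notin> graded_ids G scale A" "q \<notin> graded_ids G scale A"
  shows "p * q \<notin> graded_ids G scale A"
  using assms unfolding strongly_verbally_prime_def homogeneous_iff by blast

text \<open>
  The product of two variables of degrees \<open>x\<close> and \<open>y\<close> is not an identity if neither variable is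
  one, hence the support of the grading is closed under multiplication. It contains \<open>\<one>\<close>, and inverses by
  transposing a position. So it is a subgroup, and connectedness makes it \<open>G\<close>.
\<close>

lemma all_components_nonzero:
  assumes svp: "strongly_verbally_prime G scale A" and conn: "connected_grading G A"
    and g: "g \<in> carrier G"
  shows "A g \<noteq> {0}"
proof -
  let ?D = "{g \<in> carrier G. A g \<noteq> {0}}"
  have mult: "x \<otimes> y \<in> ?D" if x: "x \<in> ?D" and y: "y \<in> ?D" for x y
  proof -
    let ?p = "Poly_Mapping.single (Word [(0, x)]) (1::'f)"
      and ?q = "Poly_Mapping.single (Word [(1, y)]) (1::'f)"
    have pq: "?p * ?q \<notin> graded_ids G scale A"
      using x y by (intro product_not_identity[OF svp, of _ _ x y])
        (simp_all add: graded_polys_single has_degree_single monomial_not_identity poly_vars_def)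
    moreover have "?p * ?q \<in> graded_polys G"
      using x y by (intro graded_polys_mult graded_polys_single) auto
    ultimately obtain s where s: "graded_subst s" "ev s (?p * ?q) \<noteq> 0"
      using graded_ids_iff by blast
    have "ev s (?p * ?q) \<in> A (x \<otimes> y)"
      using s(1) x y unfolding ev_mult
      by (intro components_mult) (auto simp: graded_subst_def)
    then show ?thesis using s(2) x y by auto
  qed
  have inv: "inv x \<in> ?D" if x: "x \<in> ?D" for x
  proof -
    obtain a where a: "a \<in> A x" "a \<noteq> 0" using x zero_component[of x] by blast
    then obtain h i j where "coef a (h, i, j) \<noteq> 0" using nonzero_coef by blast
    note c = component_coef[OF a(1) _ this]
    have hH: "inv h \<in> H" using c(1) x by auto
    have "inv h = gs ! j \<otimes> inv x \<otimes> inv (gs ! i)"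
      using c x by (simp add: inv_mult_group m_ac)
    then have "E (inv h, j, i) \<in> A (inv x)"
      using hH c(2,3) x by (intro E_component) simp_all
    moreover have "E (inv h, j, i) \<noteq> 0" using hH c(2,3) x by (intro E_nonzero) simp
    ultimately show ?thesis using x by auto
  qed
  have one: "\<one> \<in> ?D" using u_component unit_nonzero by auto
  have gen: "x \<in> ?D" if "x \<in> generate G ?D" for x
    using that
  proof (induction rule: generate.induct)
    case one
    show ?case by (rule \<open>\<one> \<in> ?D\<close>)
  next
    case (inv h)
    then show ?case by (rule \<open>\<And>x. x \<in> ?D \<Longrightarrow> inv x \<in> ?D\<close>)
  next
    case (eng h1 h2)
    then show ?case by (intro mult)
  qed
  have "g \<in> generate G ?D"
    using conn g unfolding connected_grading_def by (simp only:)
  from gen[OF this] show ?thesis by simp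
qed

text \<open>
  An index for the \<open>k\<close>-th variable of kind \<open>q\<close> in the \<open>b\<close>-th factor of a product, where the kinds
  \<open>0\<close>, \<open>1\<close>, \<open>2\<close> are the variables \<open>x\<close>, \<open>y\<close>, \<open>z\<close> of a Capelli polynomial and
  \<open>3\<close> is a separating variable. Different factors thereby have disjoint variables.
\<close>

definition slot :: "nat \<Rightarrow> nat \<Rightarrow> nat \<Rightarrow> nat" where
  "slot b q k = prod_encode (b, prod_encode (q, k))"

lemma slot_eq_iff [simp]: "slot b q k = slot b' q' k' \<longleftrightarrow> b = b' \<and> q = q' \<and> k = k'"
  by (simp add: slot_def prod_encode_eq)

definition capelli_block :: "nat \<Rightarrow> nat \<Rightarrow> (nat \<times> 'g, 'f) free_alg" where
  "capelli_block b N = capelli N (\<lambda>k. (slot b 0 k, \<one>)) (\<lambda>k. (slot b 1 k, \<one>)) (\<lambda>k. (slot b 2 k, \<one>))"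

lemma capelli_block_vars:
  "poly_vars (capelli_block b N) \<subseteq> {(slot b q k, \<one>) | q k. q < 3}"
  unfolding capelli_block_def by (rule order.trans[OF poly_vars_capelli]) auto

lemma capelli_block_graded: "capelli_block b N \<in> graded_polys G"
  using capelli_block_vars[of b N] by (auto simp: graded_polys_def)

lemma capelli_block_degree: "has_degree G (capelli_block b N) \<one>"
  unfolding has_degree_def
proof (intro conjI ballI)
  fix w assume "w \<in> Poly_Mapping.keys (capelli_block b N)"
  then have "snd ` set (letters w) \<subseteq> {\<one>}"
    using capelli_block_vars[of b N] by (fastforce simp: poly_vars_def)
  then have "snd ` set v \<subseteq> {\<one>} \<Longrightarrow> word_degree G v = \<one>" for v :: "(nat \<times> 'g) list"
    by (induction v) (auto simp: word_degree_def)
  then show "word_degree G (letters w) = \<one>" using \<open>snd ` set (letters w) \<subseteq> {\<one>}\<close> .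
qed simp

abbreviation coset_rows :: "nat \<Rightarrow> nat set" where
  "coset_rows i \<equiv> {l. l < m \<and> gs ! l \<in> H #> gs ! i}"

text \<open>
  The rows in the coset of row \<open>a\<close> span a full matrix algebra inside the component of degree
  \<open>\<one>\<close>. Its matrix units \<open>e i j\<close>, enumerated by \<open>f\<close>, are substituted for the alternating
  variables, and the places are fixed by \<open>y k\<close> and \<open>z k\<close>, so that the
  factor \<open>y k * x j * z k\<close> is a multiple of \<open>e a a\<close>, nonzero only for \<open>j = k\<close>. Only the
  identity permutation survives.
\<close>

lemma capelli_block_not_identity:
  assumes a: "a < m"
  shows "capelli_block b (coset_count (gs ! a) * coset_count (gs ! a)) \<notin> graded_ids G scale A"
proof -
  let ?N = "coset_count (gs ! a) * coset_count (gs ! a)" and ?I = "coset_rows a"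
  obtain f where f: "bij_betw f {..<?N} (?I \<times> ?I)"
    using finite_same_card_bij[of "{..<?N}" "?I \<times> ?I"] by (auto simp: coset_count_def card_cartesian_product)
  have aI: "a \<in> ?I" using a subgroup_H by (auto intro: rcos_self)
  have H: "gs ! i \<otimes> inv (gs ! j) \<in> H" if "i \<in> ?I" "j \<in> ?I" for i j
    using that a by (metis (mono_tags, lifting) gs_carrier mem_Collect_eq rcoset_eq_iff rcoset_iff)
  define e where "e i j = E (gs ! i \<otimes> inv (gs ! j), i, j)" for i j
  have e_comp: "e i j \<in> A \<one>" if "i \<in> ?I" "j \<in> ?I" for i j
    unfolding e_def using that H[OF that] by (intro E_component) auto
  have e_mult: "\<exists>r. r \<noteq> 0 \<and> e i j * e k l = (if j = k then scale r (e i l) else 0)"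
    if "i \<in> ?I" "j \<in> ?I" "k \<in> ?I" "l \<in> ?I" for i j k l
  proof -
    have "gs ! i \<otimes> inv (gs ! j) \<otimes> (gs ! j \<otimes> inv (gs ! l)) = gs ! i \<otimes> inv (gs ! l)"
      using that by (simp add: m_assoc)
    then have "e i j * e k l = (if j = k
        then scale (c (gs ! i \<otimes> inv (gs ! j)) (gs ! k \<otimes> inv (gs ! l))) (e i l) else 0)"
      unfolding e_def using that H by (auto simp: E_mult)
    moreover have "c (gs ! i \<otimes> inv (gs ! j)) (gs ! k \<otimes> inv (gs ! l)) \<noteq> 0"
      by (rule c_nonzero[OF H[OF that(1,2)] H[OF that(3,4)]])
    ultimately show ?thesis by blast
  qed
  define x where "x k = e (fst (f k)) (snd (f k))" for k
  define y where "y k = e a (fst (f k))" for k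
  define z where "z k = e (snd (f k)) a" for k
  have fI: "fst (f k) \<in> ?I" "snd (f k) \<in> ?I" if "k < ?N" for k
    using bij_betw_apply[OF f, of k] that by (auto simp: mem_Times_iff)
  define s where "s v = (case prod_decode (fst v) of (b, d) \<Rightarrow> case prod_decode d of (q, k) \<Rightarrow>
     if snd v = \<one> \<and> k < ?N then (if q = 0 then x k else if q = 1 then y k else z k) else 0)"
    for v :: "nat \<times> 'g"
  have "graded_subst s"
    unfolding graded_subst_def
  proof (intro allI ballI)
    fix i g assume g: "g \<in> carrier G"
    obtain b d where d: "prod_decode i = (b, d)" by fastforce
    obtain q k where k: "prod_decode d = (q, k)" by fastforce
    show "s (i, g) \<in> A g"
      using d k g fI[of k] aI by (auto simp: s_def x_def y_def z_def zero_component intro!: e_comp)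
  qed
  moreover have "ev s (capelli_block b ?N) \<noteq> 0"
  proof -
    have factor: "\<exists>r. y k * x j * z k = scale r (e a a) \<and> (r \<noteq> 0 \<longleftrightarrow> j = k)" if kj: "k < ?N" "j < ?N" for k j
    proof (cases "j = k")
      case True
      obtain r where r: "r \<noteq> 0" "y k * x k = scale r (e a (snd (f k)))"
        using e_mult[OF aI fI(1)[OF kj(1)] fI(1)[OF kj(1)] fI(2)[OF kj(1)]]
        by (auto simp: y_def x_def)
      obtain r' where r': "r' \<noteq> 0" "e a (snd (f k)) * z k = scale r' (e a a)"
        using e_mult[OF aI fI(2)[OF kj(1)] fI(2)[OF kj(1)] aI] by (auto simp: z_def)
      have "y k * x k * z k = scale (r * r') (e a a)"
        using r r' by (simp add: mult_scale_left)
      then show ?thesis using r r' True by (intro exI[of _ "r * r'"]) simp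
    next
      case False
      then have "f j \<noteq> f k" using f kj by (auto simp: bij_betw_def inj_on_def)
      then consider "fst (f k) \<noteq> fst (f j)" | "snd (f j) \<noteq> snd (f k)" by (metis prod.expand)
      then have "y k * x j * z k = 0"
      proof cases
        case 1
        then have "y k * x j = 0"
          using e_mult[OF aI fI(1)[OF kj(1)] fI(1)[OF kj(2)] fI(2)[OF kj(2)]]
          by (auto simp: y_def x_def)
        then show ?thesis by simp
      next
        case 2
        then have "x j * z k = 0"
          using e_mult[OF fI(1)[OF kj(2)] fI(2)[OF kj(2)] fI(2)[OF kj(1)] aI]
          by (auto simp: z_def x_def)
        then show ?thesis by (simp add: mult.assoc)
      qed
      then show ?thesis using False by (intro exI[of _ 0]) simp
    qed
    obtain r0 where r0: "r0 \<noteq> 0" "e a a * e a a = scale r0 (e a a)"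
      using e_mult[OF aI aI aI aI] by auto
    have fold: "\<exists>r. foldr (\<lambda>k a'. y k * x (\<sigma> k) * z k * a') ks (e a a) = scale r (e a a)
        \<and> (r \<noteq> 0 \<longleftrightarrow> (\<forall>k\<in>set ks. \<sigma> k = k))"
      if \<sigma>: "\<sigma> permutes {..<?N}" and ks: "set ks \<subseteq> {..<?N}" for \<sigma> ks
      using ks
    proof (induction ks)
      case Nil
      show ?case by (intro exI[of _ 1]) simp
    next
      case (Cons k ks)
      then obtain r where r: "foldr (\<lambda>k a'. y k * x (\<sigma> k) * z k * a') ks (e a a) = scale r (e a a)"
        "r \<noteq> 0 \<longleftrightarrow> (\<forall>k\<in>set ks. \<sigma> k = k)" by auto
      have "k < ?N" "\<sigma> k < ?N" using Cons.prems permutes_in_image[OF \<sigma>] by auto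
      from factor[OF this] obtain r' where
        r': "y k * x (\<sigma> k) * z k = scale r' (e a a)" "r' \<noteq> 0 \<longleftrightarrow> \<sigma> k = k" by blast
      have "foldr (\<lambda>k a'. y k * x (\<sigma> k) * z k * a') (k # ks) (e a a) = scale (r' * r * r0) (e a a)"
        using r(1) r'(1) r0(2) by (simp add: mult_scale_left mult_scale_right mult.commute)
      then show ?case using r(2) r'(2) r0(1) by (intro exI[of _ "r' * r * r0"]) auto
    qed
    have fold_mult: "foldr (\<lambda>k. (*) (g k)) ks u * v = foldr (\<lambda>k. (*) (g k)) ks v" for g :: "nat \<Rightarrow> 'a" and ks v
      by (induction ks) (simp_all add: mult.assoc)
    let ?F = "\<lambda>\<sigma>. foldr (\<lambda>k a'. y k * x (\<sigma> k) * z k * a') [0..<?N] (e a a)"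
    have s_slot: "s (slot b 0 k, \<one>) = x k" "s (slot b 1 k, \<one>) = y k" "s (slot b 2 k, \<one>) = z k"
      if "k < ?N" for k
      using that by (simp_all add: s_def slot_def)
    have fold_eq: "foldr (\<lambda>k a'. s (slot b 1 k, \<one>) * s (slot b 0 (\<sigma> k), \<one>) * s (slot b 2 k, \<one>) * a') [0..<?N] v
        = foldr (\<lambda>k a'. y k * x (\<sigma> k) * z k * a') [0..<?N] v" if "\<sigma> permutes {..<?N}" for \<sigma> v
      using permutes_in_image[OF that] by (intro foldr_cong refl) (simp add: s_slot s_slot(2)[simplified])
    \<comment> \<open>Multiplying by \<open>e a a\<close> puts it in the place of the unit at the end of each product.\<close>
    have "ev s (capelli_block b ?N) * e a a = (\<Sum>\<sigma> | \<sigma> permutes {..<?N}. scale (of_int (sign \<sigma>)) (?F \<sigma>))"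
      unfolding capelli_block_def ev_capelli sum_distrib_right
      by (intro sum.cong refl) (simp only: mem_Collect_eq fold_eq mult_scale_left fold_mult)
    also have "\<dots> = (\<Sum>\<sigma> | \<sigma> permutes {..<?N}. if \<sigma> = id then ?F id else 0)"
    proof (intro sum.cong refl)
      fix \<sigma> assume "\<sigma> \<in> {\<sigma>. \<sigma> permutes {..<?N}}"
      then have \<sigma>: "\<sigma> permutes {..<?N}" by simp
      show "scale (of_int (sign \<sigma>)) (?F \<sigma>) = (if \<sigma> = id then ?F id else 0)"
      proof (cases "\<sigma> = id")
        case False
        then obtain k where "\<sigma> k \<noteq> k" by (auto simp: fun_eq_iff)
        moreover from this have "k < ?N" using \<sigma> by (auto simp: permutes_def)
        ultimately have "?F \<sigma> = 0" using fold[OF \<sigma>, of "[0..<?N]"] by fastforce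
        then show ?thesis using False by simp
      qed simp
    qed
    also have "\<dots> = ?F id" by (simp add: finite_permutations permutes_id)
    also have "\<dots> \<noteq> 0"
    proof -
      obtain r where "?F id = scale r (e a a)" "r \<noteq> 0"
        using fold[OF permutes_id, of "[0..<?N]"] by (auto simp: atLeast0LessThan)
      moreover have "e a a \<noteq> 0"
        unfolding e_def using H[OF aI aI] a by (intro E_nonzero) auto
      ultimately show ?thesis by simp
    qed
    finally show ?thesis by auto
  qed
  ultimately show ?thesis using graded_ids_iff[OF capelli_block_graded] by blast
qed

text \<open>
  Elements of degree \<open>\<one>\<close> do not leave the coset of a row. In the rows of the coset of \<open>i\<close> they
  are therefore described by \<open>(coset_count (gs ! i))\<^sup>2\<close> coordinates, and for larger \<open>N\<close> some combination of the
  alternating values vanishes in these rows. The elements vanishing there form a right ideal that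
  is closed under multiplication from the left by elements of degree \<open>\<one>\<close>.
\<close>

lemma capelli_block_support:
  assumes s: "graded_subst s" and coef: "coef (ev s (capelli_block b N)) (h, i, j) \<noteq> 0"
  shows "N \<le> coset_count (gs ! i) * coset_count (gs ! i)"
proof (rule ccontr)
  assume small: "\<not> N \<le> coset_count (gs ! i) * coset_count (gs ! i)"
  let ?I = "coset_rows i"
  have i: "i < m" using coef_nonzero[OF coef] by simp
  have card: "card (?I \<times> ?I) < card {..<N}"
    using small by (simp add: coset_count_def card_cartesian_product)
  have step: "l' \<in> ?I" if "coef a (h', l, l') \<noteq> 0" "a \<in> A \<one>" "l \<in> ?I" for a h' l l'
  proof -
    note c = component_coef[OF that(2) _ that(1)]
    then have "gs ! l \<otimes> inv (gs ! l') \<in> H" by simp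
    then have "H #> gs ! l = H #> gs ! l'" using c by (simp add: rcoset_eq_iff)
    moreover have "H #> gs ! l = H #> gs ! i" using that(3) i by (auto simp: rcoset_eq_iff rcoset_iff H_closed)
    ultimately have "H #> gs ! l' = H #> gs ! i" by simp
    then have "gs ! l' \<in> H #> gs ! i" using c i by (simp add: rcoset_iff rcoset_eq_iff)
    then show ?thesis using c by simp
  qed
  define W where "W = {a. \<forall>h l l'. l \<in> ?I \<longrightarrow> coef a (h, l, l') = 0}"
  let ?x = "\<lambda>k. s (slot b 0 k, \<one>)"
  have in_A: "s (n, \<one>) \<in> A \<one>" for n using s by (simp add: graded_subst_def)
  have "\<exists>\<beta>. (\<exists>j\<in>{..<N}. \<beta> j \<noteq> 0) \<and> (\<forall>p\<in>?I \<times> ?I.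
      (\<Sum>j<N. \<beta> j * coef (?x j) (gs ! fst p \<otimes> inv (gs ! snd p), fst p, snd p)) = 0)"
    by (rule linear_system_nontrivial_solution[OF _ _ card]) simp_all
  then obtain \<beta> where \<beta>: "\<exists>j\<in>{..<N}. \<beta> j \<noteq> 0"
    "\<forall>p\<in>?I \<times> ?I. (\<Sum>j<N. \<beta> j * coef (?x j) (gs ! fst p \<otimes> inv (gs ! snd p), fst p, snd p)) = 0"
    by blast
  let ?v = "\<Sum>j<N. scale (\<beta> j) (?x j)"
  have v: "?v \<in> A \<one>" by (intro sum_scale_component in_A) simp
  have "?v \<in> W"
    unfolding W_def
  proof (intro CollectI allI impI, rule ccontr)
    fix h l l' assume l: "l \<in> ?I" and nz: "coef ?v (h, l, l') \<noteq> 0"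
    have "l' \<in> ?I" by (rule step[OF nz v l])
    moreover have "h = gs ! l \<otimes> inv (gs ! l')" using component_coef[OF v _ nz] by simp
    ultimately have "coef ?v (h, l, l') = 0"
      using bspec[OF \<beta>(2), of "(l, l')"] l by (simp add: coef_sum coef_scale)
    with nz show False ..
  qed
  obtain j0 where j0: "j0 < N" "\<beta> j0 \<noteq> 0" using \<beta>(1) by blast
  have "ev s (capelli_block b N) \<in> W"
    unfolding capelli_block_def
  proof (rule capelli_value_mem[where B = "A \<one>" and \<beta> = \<beta> and ?j0.0 = j0])
    show "subspace W" by (rule subspaceI) (auto simp: W_def coef_add coef_scale)
    show "a * a' \<in> W" if "a \<in> W" for a a'
      using that coef_mult_support[of a a'] unfolding W_def by blast
    show "a * a' \<in> W" if "a \<in> A \<one>" "a' \<in> W" for a a'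
      using that coef_mult_support[of a a'] step[of a] unfolding W_def by blast
    show "a * a' \<in> A \<one>" if "a \<in> A \<one>" "a' \<in> A \<one>" for a a'
      using components_mult[OF _ _ that] by simp
  qed (use in_A u_component \<open>?v \<in> W\<close> j0 in auto)
  moreover have "i \<in> ?I" using i subgroup_H by (auto intro: rcos_self)
  ultimately show False using coef unfolding W_def by blast
qed

lemma coset_count_cong: "x \<in> carrier G \<Longrightarrow> y \<in> carrier G \<Longrightarrow> x \<otimes> inv y \<in> H \<Longrightarrow> coset_count x = coset_count y"
  unfolding coset_count_def using rcoset_eq_iff[of y x] by simp

definition translated_rows_represented :: "nat \<Rightarrow> 'g set \<Rightarrow> (nat \<times> 'g, 'f) free_alg \<Rightarrow> bool" where
  "translated_rows_represented d T p \<longleftrightarrow>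
     (\<forall>s h i j. graded_subst s \<longrightarrow> coef (ev s p) (h, i, j) \<noteq> 0 \<longrightarrow> (\<forall>t\<in>T. coset_count (gs ! i \<otimes> t) = d))"

text \<open>
  To add \<open>t\<close> to \<open>T\<close>, the polynomial \<open>p\<close> of degree \<open>g\<close> is multiplied by a variable of degree
  \<open>inv g \<otimes> t\<close> and by a Capelli polynomial in fresh variables. The first two factors carry row
  \<open>i\<close> into the coset of \<open>gs ! i \<otimes> t\<close>, and there the last factor is nonzero only if this coset is one of
  those represented most often. Strong verbal primeness keeps the product from being an identity.
\<close>

lemma polynomial_with_full_support:
  assumes svp: "strongly_verbally_prime G scale A" and conn: "connected_grading G A"
    and a: "a < m" "\<And>i. i < m \<Longrightarrow> coset_count (gs ! i) \<le> coset_count (gs ! a)"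
    and T: "finite T" "T \<subseteq> carrier G"
  shows "\<exists>p n g. p \<in> graded_polys G \<and> has_degree G p g \<and> p \<notin> graded_ids G scale A \<and>
    poly_vars p \<subseteq> {(slot b q k, x) | b q k x. b < n} \<and>
    translated_rows_represented (coset_count (gs ! a)) T p"
  using T
proof (induction T rule: finite_induct)
  case empty
  let ?p = "Poly_Mapping.single 0 1 :: (nat \<times> 'g, 'f) free_alg"
  have p: "?p \<in> graded_polys G" by (simp add: graded_polys_def poly_vars_def zero_fmon_def)
  have "graded_subst (\<lambda>_. 0)" by (simp add: graded_subst_def zero_component)
  moreover have "ev s ?p = u" for s by (simp add: zero_fmon_def)
  ultimately have "?p \<notin> graded_ids G scale A" using graded_ids_iff[OF p] unit_nonzero by metis
  moreover have "has_degree G ?p \<one>" by (simp add: has_degree_def zero_fmon_def word_degree_def)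
  moreover have "poly_vars ?p = {}" by (simp add: poly_vars_def zero_fmon_def)
  moreover have "translated_rows_represented (coset_count (gs ! a)) {} ?p" by (simp add: translated_rows_represented_def)
  ultimately show ?case using p by blast
next
  case (insert t T)
  then obtain p n g where p: "p \<in> graded_polys G" "has_degree G p g" "p \<notin> graded_ids G scale A"
    and vars: "poly_vars p \<subseteq> {(slot b q k, x) | b q k x. b < n}"
    and rows: "translated_rows_represented (coset_count (gs ! a)) T p" by auto
  have supp: "coset_count (gs ! i \<otimes> t) = coset_count (gs ! a)"
    if "graded_subst s" "coef (ev s p) (h, i, j) \<noteq> 0" "t \<in> T" for s h i j t
    using rows that unfolding translated_rows_represented_def by blast
  have t: "t \<in> carrier G" and g: "g \<in> carrier G"
    using insert.prems p(2) by (auto simp: has_degree_def)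
  let ?z = "Poly_Mapping.single (Word [(slot n 3 0, inv g \<otimes> t)]) 1 :: (nat \<times> 'g, 'f) free_alg"
  let ?f = "capelli_block n (coset_count (gs ! a) * coset_count (gs ! a))"
  have z: "?z \<in> graded_polys G" "has_degree G ?z (inv g \<otimes> t)"
    using t g by (auto intro: graded_polys_single has_degree_single)
  have z_not: "?z \<notin> graded_ids G scale A"
    using t g by (intro monomial_not_identity all_components_nonzero svp conn) auto
  have z_vars: "poly_vars ?z = {(slot n 3 0, inv g \<otimes> t)}" by (simp add: poly_vars_def)
  have pz: "p * ?z \<in> graded_polys G" using p(1) z(1) by (rule graded_polys_mult)
  have pz_deg: "has_degree G (p * ?z) t"
    using has_degree_mult[OF p(1) z(1) p(2) z(2)] t g by simp
  have pz_vars: "poly_vars (p * ?z) \<subseteq> poly_vars p \<union> {(slot n 3 0, inv g \<otimes> t)}"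
    using poly_vars_mult[of p ?z] z_vars by simp
  have pz_not: "p * ?z \<notin> graded_ids G scale A"
    by (rule product_not_identity[OF svp p(1) z(1) p(2) z(2) _ p(3) z_not])
      (use vars z_vars in auto)
  have f_vars: "poly_vars ?f \<subseteq> {(slot n q k, \<one>) | q k. q < 3}" by (rule capelli_block_vars)
  have disj: "poly_vars (p * ?z) \<inter> poly_vars ?f = {}"
  proof (intro equals0I, elim IntE)
    fix v assume v: "v \<in> poly_vars (p * ?z)" "v \<in> poly_vars ?f"
    from v(2) f_vars obtain q k where "v = (slot n q k, \<one>)" "q < 3" by blast
    moreover from v(1) pz_vars vars have "v = (slot n 3 0, inv g \<otimes> t) \<or> (\<exists>b q k x. v = (slot b q k, x) \<and> b < n)"
      by blast
    ultimately show False by auto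
  qed
  have pzf_not: "p * ?z * ?f \<notin> graded_ids G scale A"
    by (rule product_not_identity[OF svp pz capelli_block_graded pz_deg capelli_block_degree _ pz_not
          capelli_block_not_identity[OF a(1)]])
      (rule disj)
  have pzf: "p * ?z * ?f \<in> graded_polys G" using pz capelli_block_graded by (rule graded_polys_mult)
  have pzf_deg: "has_degree G (p * ?z * ?f) t"
    using has_degree_mult[OF pz capelli_block_graded pz_deg capelli_block_degree] t by simp
  have pzf_vars: "poly_vars (p * ?z * ?f) \<subseteq> {(slot b q k, x) | b q k x. b < Suc n}"
  proof
    fix v assume "v \<in> poly_vars (p * ?z * ?f)"
    with poly_vars_mult[of "p * ?z" ?f] pz_vars
    consider "v \<in> poly_vars p" | "v = (slot n 3 0, inv g \<otimes> t)" | "v \<in> poly_vars ?f" by blast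
    then show "v \<in> {(slot b q k, x) | b q k x. b < Suc n}"
    proof cases
      case 1
      with vars obtain b q k x where "v = (slot b q k, x)" "b < n" by blast
      then show ?thesis using less_SucI by blast
    next
      case 2
      then show ?thesis by blast
    next
      case 3
      with f_vars show ?thesis by blast
    qed
  qed
  have pzf_supp: "coset_count (gs ! i \<otimes> t') = coset_count (gs ! a)"
    if s: "graded_subst s" and coef: "coef (ev s (p * ?z * ?f)) (h, i, j) \<noteq> 0" and t': "t' \<in> insert t T"
    for s h i j t'
  proof -
    obtain l h1 h2 where l: "coef (ev s (p * ?z)) (h1, i, l) \<noteq> 0" "coef (ev s ?f) (h2, l, j) \<noteq> 0"
      using coef_mult_support coef unfolding ev_mult[of s "p * ?z"] by blast
    obtain l' h3 where l': "coef (ev s p) (h3, i, l') \<noteq> 0"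
      using coef_mult_support l(1) unfolding ev_mult by blast
    note c = component_coef[OF ev_component[OF s pz pz_deg] t l(1)]
    have "coset_count (gs ! a) * coset_count (gs ! a) \<le> coset_count (gs ! l) * coset_count (gs ! l)"
      by (rule capelli_block_support[OF s l(2)])
    then have "coset_count (gs ! l) = coset_count (gs ! a)"
      using a(2)[OF c(3)] power2_nat_le_eq_le[of "coset_count (gs ! a)" "coset_count (gs ! l)"]
      by (simp add: power2_eq_square)
    moreover have "coset_count (gs ! i \<otimes> t) = coset_count (gs ! l)"
      using c t by (intro coset_count_cong) auto
    ultimately show ?thesis using t' supp[OF s l'] by auto
  qed
  then have pzf_rows: "translated_rows_represented (coset_count (gs ! a)) (insert t T) (p * ?z * ?f)"
    unfolding translated_rows_represented_def by blast
  show ?case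
    by (rule exI[of _ "p * ?z * ?f"], rule exI[of _ "Suc n"], rule exI[of _ t])
      (intro conjI pzf pzf_deg pzf_not pzf_vars pzf_rows)
qed

lemma equal_coset_counts_if_strongly_verbally_prime:
  assumes svp: "strongly_verbally_prime G scale A" and conn: "connected_grading G A"
    and xy: "x \<in> carrier G" "y \<in> carrier G"
  shows "coset_count x = coset_count y"
proof -
  obtain a where a: "a < m" "\<And>i. i < m \<Longrightarrow> coset_count (gs ! i) \<le> coset_count (gs ! a)"
  proof -
    let ?S = "(\<lambda>i. coset_count (gs ! i)) ` {..<m}"
    have "Max ?S \<in> ?S" using gs_nonempty by (intro Max_in) auto
    then obtain a where "a < m" "coset_count (gs ! a) = Max ?S" by auto
    then show ?thesis using that[of a] by simp
  qed
  obtain p :: "(nat \<times> 'g, 'f) free_alg" where p: "p \<in> graded_polys G" "p \<notin> graded_ids G scale A"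
    and rows: "translated_rows_represented (coset_count (gs ! a)) (carrier G) p"
    using polynomial_with_full_support[OF svp conn a finite_carrier order.refl] by blast
  obtain s where s: "graded_subst s" "ev s p \<noteq> 0" using p graded_ids_iff by blast
  obtain h i j where i: "coef (ev s p) (h, i, j) \<noteq> 0" "i < m" using nonzero_coef[OF s(2)] by blast
  have "coset_count z = coset_count (gs ! a)" if z: "z \<in> carrier G" for z
  proof -
    have "coset_count (gs ! i \<otimes> (inv (gs ! i) \<otimes> z)) = coset_count (gs ! a)"
      using rows s(1) i z unfolding translated_rows_represented_def by blast
    then show ?thesis using i(2) z by simp
  qed
  then show ?thesis using xy by simp
qed

end

section \<open>Presentations as coordinates\<close>

lemma lookup_tw_scale [simp]: "Poly_Mapping.lookup (tw_scale a x) k = a * Poly_Mapping.lookup x k"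
  by (simp add: tw_scale_def Poly_Mapping.map.rep_eq when_def)

lemma vector_space_tw_scale: "vector_space (tw_scale :: 'f::field \<Rightarrow> ('g, 'f) tw_mat \<Rightarrow> _)"
  by standard (auto intro!: poly_mapping_eqI simp: lookup_add algebra_simps)

lemma keys_tw_scale: "Poly_Mapping.keys (tw_scale a x) \<subseteq> Poly_Mapping.keys x"
  by (auto simp: in_keys_iff)

lemma tw_sum_singles:
  assumes "finite S" "Poly_Mapping.keys x \<subseteq> S"
  shows "x = (\<Sum>k\<in>S. tw_scale (Poly_Mapping.lookup x k) (Poly_Mapping.single k 1))"
  using assms
  by (intro poly_mapping_eqI)
    (auto simp: lookup_sum lookup_single when_def in_keys_iff if_distrib[of "(*) _"]
      cong: if_cong)

text \<open>
  Carrier and components are given as spans of basis vectors; in terms of supports, membership can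
  be tested on coordinates.
\<close>

lemma span_singles:
  fixes S :: "('g \<times> nat \<times> nat) set"
  shows "module.span (tw_scale :: 'f::field \<Rightarrow> _) ((\<lambda>k. Poly_Mapping.single k 1) ` S)
    = {x. Poly_Mapping.keys x \<subseteq> S}"
proof -
  interpret tw: vector_space "tw_scale :: 'f \<Rightarrow> ('g, 'f) tw_mat \<Rightarrow> _" by (rule vector_space_tw_scale)
  show ?thesis
  proof
    have "tw.subspace {x. Poly_Mapping.keys x \<subseteq> S}"
      by (intro tw.subspaceI) (auto dest: subsetD[OF keys_add] subsetD[OF keys_tw_scale])
    then show "tw.span ((\<lambda>k. Poly_Mapping.single k 1) ` S) \<subseteq> {x. Poly_Mapping.keys x \<subseteq> S}"
      by (intro tw.span_minimal) auto
    show "{x. Poly_Mapping.keys x \<subseteq> S} \<subseteq> tw.span ((\<lambda>k. Poly_Mapping.single k 1) ` S)"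
    proof
      fix x :: "('g, 'f) tw_mat" assume "x \<in> {x. Poly_Mapping.keys x \<subseteq> S}"
      then have "(\<Sum>k\<in>Poly_Mapping.keys x. tw_scale (Poly_Mapping.lookup x k) (Poly_Mapping.single k 1))
          \<in> tw.span ((\<lambda>k. Poly_Mapping.single k 1) ` S)"
        by (intro tw.span_sum tw.span_scale tw.span_base) auto
      then show "x \<in> tw.span ((\<lambda>k. Poly_Mapping.single k 1) ` S)"
        using tw_sum_singles[of "Poly_Mapping.keys x" x] by simp
    qed
  qed
qed

lemma tw_carrier_eq:
  "tw_carrier H m = {x :: ('g, 'f::field) tw_mat. Poly_Mapping.keys x \<subseteq> H \<times> {..<m} \<times> {..<m}}"
proof -
  have "{Poly_Mapping.single (h, i, j) (1::'f) | h i j. h \<in> H \<and> i < m \<and> j < m}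
      = (\<lambda>k. Poly_Mapping.single k 1) ` (H \<times> {..<m} \<times> {..<m})" by auto
  then show ?thesis unfolding tw_carrier_def by (simp only: span_singles)
qed

lemma tw_component_eq:
  "tw_component G H gs g = {x :: ('g, 'f::field) tw_mat. Poly_Mapping.keys x \<subseteq>
     {(h, i, j). h \<in> H \<and> i < length gs \<and> j < length gs
        \<and> g = inv\<^bsub>G\<^esub> (gs ! i) \<otimes>\<^bsub>G\<^esub> h \<otimes>\<^bsub>G\<^esub> (gs ! j)}}"
proof -
  have "{Poly_Mapping.single (h, i, j) (1::'f) | h i j. h \<in> H \<and> i < length gs \<and> j < length gs
        \<and> g = inv\<^bsub>G\<^esub> (gs ! i) \<otimes>\<^bsub>G\<^esub> h \<otimes>\<^bsub>G\<^esub> (gs ! j)}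
      = (\<lambda>k. Poly_Mapping.single k 1) ` {(h, i, j). h \<in> H \<and> i < length gs \<and> j < length gs
        \<and> g = inv\<^bsub>G\<^esub> (gs ! i) \<otimes>\<^bsub>G\<^esub> h \<otimes>\<^bsub>G\<^esub> (gs ! j)}" by auto
  then show ?thesis unfolding tw_component_def by (simp only: span_singles)
qed

lemma tw_mult_single:
  "tw_mult G c (Poly_Mapping.single (h, i, j) 1) (Poly_Mapping.single (h', k, l) 1)
     = (if j = k then tw_scale (c h h') (Poly_Mapping.single (h \<otimes>\<^bsub>G\<^esub> h', i, l) 1) else 0)"
  by (auto simp: tw_mult_def lookup_single when_def intro!: poly_mapping_eqI)

text \<open>
  Basis and coordinates of the twisted matrix algebra are transported along \<open>\<phi>\<close>. A nonzero
  product ensures that there is at least one row.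
\<close>

lemma graded_iso_tw_model:
  fixes G :: "('g, 'b) monoid_scheme"
    and scale :: "'f::field_char_0 \<Rightarrow> 'a::ring \<Rightarrow> 'a"
  assumes G: "comm_group G" "finite (carrier G)" and A: "graded_algebra G scale A"
    and nonzero: "\<exists>x y :: 'a. x * y \<noteq> 0"
    and H: "subgroup H G" and gs: "set gs \<subseteq> carrier G" and c: "c \<in> cocycles G H"
    and iso: "graded_iso_tw G scale A H c gs \<phi>"
  shows "\<exists>E coef. graded_matrix_model G scale A H c gs E coef"
proof -
  interpret comm_group G by (rule G)
  interpret graded_algebra G scale A by (rule A)
  let ?m = "length gs"
  let ?K = "H \<times> {..<?m} \<times> {..<?m}"
  let ?C = "tw_carrier H ?m :: ('g, 'f) tw_mat set"
  have fin: "finite ?K"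
    using finite_subset[OF subgroup.subset[OF H] G(2)] by simp
  have bij: "bij_betw \<phi> ?C UNIV"
    and \<phi>_add: "\<And>x y. x \<in> ?C \<Longrightarrow> y \<in> ?C \<Longrightarrow> \<phi> (x + y) = \<phi> x + \<phi> y"
    and \<phi>_mult: "\<And>x y. x \<in> ?C \<Longrightarrow> y \<in> ?C \<Longrightarrow> \<phi> (tw_mult G c x y) = \<phi> x * \<phi> y"
    and \<phi>_scale: "\<And>r x. x \<in> ?C \<Longrightarrow> \<phi> (tw_scale r x) = scale r (\<phi> x)"
    and \<phi>_comp: "\<And>g. g \<in> carrier G \<Longrightarrow> \<phi> ` tw_component G H gs g = A g"
    using iso unfolding graded_iso_tw_def by auto
  have C_add: "x + y \<in> ?C" if "x \<in> ?C" "y \<in> ?C" for x y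
    using that keys_add[of x y] unfolding tw_carrier_eq by blast
  have C_scale: "tw_scale r x \<in> ?C" if "x \<in> ?C" for r x
    using that keys_tw_scale[of r x] unfolding tw_carrier_eq by blast
  have C_zero: "0 \<in> ?C" by (simp add: tw_carrier_eq)
  have C_single: "Poly_Mapping.single k 1 \<in> ?C" if "k \<in> ?K" for k
    using that by (simp add: tw_carrier_eq)
  have \<phi>_zero: "\<phi> 0 = 0"
    using \<phi>_add[OF C_zero C_zero] by simp
  define \<psi> where "\<psi> = the_inv_into ?C \<phi>"
  have \<psi>_C: "\<psi> a \<in> ?C" for a
    using bij the_inv_into_into[of \<phi> ?C a ?C] by (simp add: \<psi>_def bij_betw_def)
  have \<phi>\<psi>: "\<phi> (\<psi> a) = a" for a
    using bij by (simp add: \<psi>_def bij_betw_def f_the_inv_into_f)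
  have \<psi>\<phi>: "\<psi> (\<phi> x) = x" if "x \<in> ?C" for x
    using bij that by (simp add: \<psi>_def bij_betw_def the_inv_into_f_f)
  define E where "E k = \<phi> (Poly_Mapping.single k 1)" for k
  define coef where "coef a = Poly_Mapping.lookup (\<psi> a)" for a
  have "graded_matrix_model G scale A H c gs E coef"
  proof (rule graded_matrix_model.intro[OF G(1) A], rule graded_matrix_model_axioms.intro)
    show "finite (carrier G)" by (rule G)
    show "subgroup H G" by (rule H)
    show "set gs \<subseteq> carrier G" by (rule gs)
    show "c \<in> cocycles G H" by (rule c)
    show "gs \<noteq> []"
    proof
      assume "gs = []"
      then have "?C = {0}" by (auto simp: tw_carrier_eq)
      then have "a = 0" for a :: 'a using \<psi>_C[of a] \<phi>\<psi>[of a] \<phi>_zero by simp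
      then show False using nonzero by (metis mult_zero_left)
    qed
    show "E (h, i, j) * E (h', i', l) = (if j = i' then scale (c h h') (E (h \<otimes>\<^bsub>G\<^esub> h', i, l)) else 0)"
      if "h \<in> H" "h' \<in> H" "i < ?m" "j < ?m" "i' < ?m" "l < ?m" for h h' i j i' l
    proof -
      have "(h \<otimes>\<^bsub>G\<^esub> h', i, l) \<in> ?K" using that subgroup.m_closed[OF H] by simp
      then show ?thesis
        unfolding E_def using that
        by (subst \<phi>_mult[symmetric]) (simp_all add: C_single tw_mult_single \<phi>_scale \<phi>_zero)
    qed
    show "coef (a + b) k = coef a k + coef b k" for a b k
    proof -
      have "\<psi> (a + b) = \<psi> a + \<psi> b"
        using \<psi>\<phi>[OF C_add[OF \<psi>_C \<psi>_C], of a b] by (simp add: \<phi>_add \<psi>_C \<phi>\<psi>)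
      then show ?thesis by (simp add: coef_def lookup_add)
    qed
    show "coef (scale r a) k = r * coef a k" for r a k
    proof -
      have "\<psi> (scale r a) = tw_scale r (\<psi> a)"
        using \<psi>\<phi>[OF C_scale[OF \<psi>_C], of r a] by (simp add: \<phi>_scale \<psi>_C \<phi>\<psi>)
      then show ?thesis by (simp add: coef_def)
    qed
    show "coef (E k) k' = (if k' = k then 1 else 0)" if "k \<in> ?K" for k k'
      using \<psi>\<phi>[OF C_single[OF that]] by (auto simp: coef_def E_def lookup_single when_def)
    show "k \<in> ?K" if "coef a k \<noteq> 0" for a k
      using \<psi>_C[of a] that unfolding tw_carrier_eq coef_def by (auto simp: in_keys_iff)
    show "a = (\<Sum>k\<in>?K. scale (coef a k) (E k))" for a
    proof -
      have sum: "(\<Sum>k\<in>S. tw_scale (r k) (Poly_Mapping.single k 1)) \<in> ?C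
          \<and> \<phi> (\<Sum>k\<in>S. tw_scale (r k) (Poly_Mapping.single k 1)) = (\<Sum>k\<in>S. scale (r k) (E k))"
        if "finite S" "S \<subseteq> ?K" for S and r :: "_ \<Rightarrow> 'f"
        using that
        by (induction S rule: finite_induct)
          (simp_all add: C_zero \<phi>_zero C_add C_scale C_single \<phi>_add \<phi>_scale E_def del: mem_Sigma_iff)
      have "\<psi> a = (\<Sum>k\<in>?K. tw_scale (Poly_Mapping.lookup (\<psi> a) k) (Poly_Mapping.single k 1))"
        using \<psi>_C[of a] by (intro tw_sum_singles fin) (simp add: tw_carrier_eq)
      then have "\<phi> (\<psi> a) = (\<Sum>k\<in>?K. scale (coef a k) (E k))"
        using sum[OF fin, of "Poly_Mapping.lookup (\<psi> a)"] by (simp add: coef_def)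
      then show ?thesis by (simp add: \<phi>\<psi>)
    qed
    show "a \<in> A g \<longleftrightarrow> (\<forall>h i j. coef a (h, i, j) \<noteq> 0 \<longrightarrow> g = inv\<^bsub>G\<^esub> (gs ! i) \<otimes>\<^bsub>G\<^esub> h \<otimes>\<^bsub>G\<^esub> gs ! j)"
      if g: "g \<in> carrier G" for a g
    proof -
      have sub: "tw_component G H gs g \<subseteq> ?C"
        unfolding tw_component_eq tw_carrier_eq by blast
      have "a \<in> A g \<longleftrightarrow> \<psi> a \<in> tw_component G H gs g"
        using \<phi>_comp[OF g] sub \<phi>\<psi> \<psi>\<phi> by (metis (no_types, lifting) image_iff subsetD)
      also have "\<dots> \<longleftrightarrow> (\<forall>h i j. coef a (h, i, j) \<noteq> 0 \<longrightarrow> g = inv\<^bsub>G\<^esub> (gs ! i) \<otimes>\<^bsub>G\<^esub> h \<otimes>\<^bsub>G\<^esub> gs ! j)"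
        using \<psi>_C[of a] unfolding tw_component_eq tw_carrier_eq coef_def
        by (auto simp: subset_iff in_keys_iff)
      finally show ?thesis .
    qed
  qed
  then show ?thesis by blast
qed

lemma (in graded_matrix_model) equally_represented_iff:
  "equally_represented G H gs \<longleftrightarrow> (\<forall>x\<in>carrier G. \<forall>y\<in>carrier G. coset_count x = coset_count y)"
  by (auto simp: equally_represented_def RCOSETS_def coset_count_def)

theorem corollary1p10:
  fixes G :: "('g, 'b) monoid_scheme"
    and scale :: "'f::{alg_closed_field, field_char_0} \<Rightarrow> 'a::ring \<Rightarrow> 'a"
    and A :: "'g \<Rightarrow> 'a set"
    and H :: "'g set"
    and \<alpha> :: "('g \<Rightarrow> 'g \<Rightarrow> 'f) set"
    and gs :: "'g list"
  assumes "comm_group G"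
    and "finite (carrier G)"
    and "graded_algebra G scale A"
    and "finite_dim_algebra scale"
    and "graded_simple G scale A"
    and "is_presentation G scale A (H, \<alpha>, gs)"
    and "connected_grading G A"
  shows "strongly_verbally_prime G scale A \<longleftrightarrow> equally_represented G H gs"
proof -
  obtain c \<phi> where P: "subgroup H G" "set gs \<subseteq> carrier G" "c \<in> cocycles G H"
    "graded_iso_tw G scale A H c gs \<phi>"
    using assms(6) unfolding is_presentation_def by blast
  have "\<exists>x y :: 'a. x * y \<noteq> 0" using assms(5) unfolding graded_simple_def by blast
  from graded_iso_tw_model[OF assms(1-3) this P] obtain E coef where
    "graded_matrix_model G scale A H c gs E coef" by blast
  then interpret graded_matrix_model G scale A H c gs E coef .
  show ?thesis
    unfolding equally_represented_iff
    using strongly_verbally_prime_if_equal_coset_counts equal_coset_counts_if_strongly_verbally_prime[OF _ assms(7)] by blast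
qed

end
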